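(* Let $\mathcal{S}$ be a trajectory set for which both assumption $(L)$-a.e. and property $(P)$ hold. Let $T\in\mathbb{N}\cup\{\infty\}$ and let $\{f_j\}_{0\le j<T+1}$ be a non-negative, real-valued supermartingale on $\mathcal{S}$; if $T<\infty$, extend it by $f_j=f_T$ for all integers $j\ge T+1$, and in all cases set $f_\infty=\liminf_{n\to\infty}f_n$. Let $\rho,\tau$ be two stopping times with $\rho\le\tau$ a.e. Then: 1. $\overline{\sigma}_\rho(f_\tau)\le f_\rho$ a.e. on $\mathcal{S}$; 2. $\overline{\sigma}_\rho(\mathbf{1}_{\{\tau<T+1\}}f_\tau)\le\mathbf{1}_{\{\rho<T+1\}}f_\rho$ a.e. on $\mathcal{S}$, where $T+1=\infty$ if $T=\infty$.
   Context: Fix $s_0\in\mathbb{R}$. A trajectory set $\mathcal{S}$ is a set of real sequences $S=(S_i)_{i\ge 0}$ with $S_0=s_0$. For $S\in\mathcal{S}$ and an integer $j\ge 0$, the node $(S,j)$ stands for $\mathcal{S}_{(S,j)}=\{\tilde S\in\mathcal{S}:\tilde S_i=S_i,\ 0\le i\le j\}$; also $\mathcal{S}_{(S,\infty)}=\{S\}$. $\mathcal{H}_{(S,j)}$ is the set of sequences $H=(H_i)_{i\ge j}$ of functions $H_i:\mathcal{S}_{(S,j)}\to\mathbb{R}$ that are non-anticipative: $H_i(\tilde S)=H_i(\hat S)$ whenever $\tilde S_k=\hat S_k$ for $j\le k\le i$. For $V\in\mathbb{R}$, $H\in\mathcal{H}_{(S,j)}$, $n\ge j$, put $\Pi^{V,H}_{j,n}(\tilde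 S)=V+\sum_{i=j}^{n-1}H_i(\tilde S)(\tilde S_{i+1}-\tilde S_i)$ for $\tilde S\in\mathcal{S}_{(S,j)}$. $\mathcal{E}_{(S,j)}$ is the set of all such functions $\Pi^{V,H}_{j,n}$, and $\mathcal{E}^+_{(S,j)}$ the set of its non-negative elements. $Q$ is the set of all functions $\mathcal{S}\to[-\infty,\infty]$ and $P\subseteq Q$ the set of non-negative ones (not to be confused with property $(P)$ below). Conventions: $0\cdot(\pm\infty)=0$, $\infty+(-\infty)=\infty$, $u-v=u+(-v)$, $\inf\emptyset=\infty$. For $f\in Q$ and a node $(S,j)$, $\overline{\sigma}_jf(S)=\inf\sum_{m\ge 0}V^m$, the infimum being over all choices of $f_0=\Pi^{V^0,H^0}_{j,n_0}\in\mathcal{E}_{(S,j)}$ and, for $m\ge1$, $f_m=\liminf_{n\to\infty}\Pi^{V^m,H^m}_{j,n}$ with $\Pi^{V^m,H^m}_{j,n}\in\mathcal{E}^+_{(S,j)}$ for all $n\ge j$, such that $f\le\sum_{m\ge0}f_m$ on $\mathcal{S}_{(S,j)}$. Put $\overline{\sigma}_\infty f(S)=f(S)$. For $f\in P$, $\overline{I}_jf(S)=\inf\sum_{m\ge1}V^m$ over all $f_m=\liminf_{n\to\infty}\Pi^{V^m,H^m}_{j,n}$, $m\ge1$, with $\Pi^{V^m,H^m}_{j,n}\in\mathcal{E}^+_{(S,j)}$ for all $n\ge j$, such that $f\le\sum_{m\ge1}f_m$ on $\mathcal{S}_{(S,j)}$. Since all trajectories start at $s_0$, $\overline{I}f:=\overline{I}_0f$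 is a number. A set $E\subseteq\mathcal{S}$ is null if $\overline{I}(\mathbf{1}_E)=0$; a property holds a.e. if it holds off a null set. Property $(L_{(S,j)})$: whenever $\Pi^{V,H}_{j,n_f}\in\mathcal{E}_{(S,j)}$ and $f_m=\liminf_{n\to\infty}\Pi^{V^m,H^m}_{j,n}$ with $\Pi^{V^m,H^m}_{j,n}\in\mathcal{E}^+_{(S,j)}$ for all $n\ge j$, $m\ge1$, satisfy $\Pi^{V,H}_{j,n_f}\le\sum_{m\ge1}f_m$ on $\mathcal{S}_{(S,j)}$, then $V\le\sum_{m\ge1}V^m$. Assumption $(L)$-a.e.: $(L_{(S,0)})$ holds, and $\{S\in\mathcal{S}:\exists j\ge0\text{ such that }(L_{(S,j)})\text{ fails}\}$ is a null set. A node $(S,j)$ is an up-down node if there are $S^1,S^2\in\mathcal{S}_{(S,j)}$ with $S^1_{j+1}<S_j<S^2_{j+1}$. Property $(P)$ of $\mathcal{S}$: whenever $(S,k)$ is an up-down node such that $(L_{(S,k)})$ holds and $(L_{(S,k+1)})$ fails, there are $S^1,S^2\in\mathcal{S}_{(S,k)}$ such that $S^1_{k+1}>S_{k+1}>S^2_{k+1}$ and $(L_{(S^n,k+1)})$ holds for $n=1,2$. A sequence $\{f_j\}_{0\le j<T+1}$ in $Q$ is non-anticipative if $f_j$ is constant on $\mathcal{S}_{(S,j)}$ for all $S\in\mathcal{S}$ and all $j$; a non-anticipative sequence is a supermartingale if for each $0\le j<T$, $\overline{\sigma}_jf_{j+1}\le f_j$ a.e. A stopping time is a function $\tau:\mathcal{S}\to\{0,1,2,\dots\}\cup\{\infty\}$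 such that for all $S,S'\in\mathcal{S}$, if $S_k=S'_k$ for all $0\le k\le\tau(S)$ (all $k\geq 0$ if $\tau(S)=\infty$), then $\tau(S)=\tau(S')$. For a stopping time $\tau$, $\overline{\sigma}_\tau g(S)=\overline{\sigma}_{\tau(S)}g(S)$ for $g\in Q$, and $f_\tau(S)=f_{\tau(S)}(S)$. *)

theory Defs
  imports Complex_Main "HOL-Library.Extended_Real" "HOL-Library.Indicator_Function"
begin

text \<open>
  Extended real functions on a trajectory set are total functions on all sequences of which only
  the values on the trajectory set matter.  The arithmetic of \<^typ>\<open>ereal\<close> has
  \<open>0 * \<infinity> = 0\<close>, \<open>\<infinity> + (-\<infinity>) = \<infinity>\<close> and \<open>Inf {} = \<infinity>\<close>, which are the
  conventions wanted here.
\<close>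

type_synonym path = "nat \<Rightarrow> real"

definition trajectory_set :: "real \<Rightarrow> path set \<Rightarrow> bool" where
  "trajectory_set s0 \<S> \<longleftrightarrow> (\<forall>S\<in>\<S>. S 0 = s0)"

definition node :: "path set \<Rightarrow> path \<Rightarrow> nat \<Rightarrow> path set" where
  "node \<S> S j = {X \<in> \<S>. \<forall>i\<le>j. X i = S i}"

definition strategies :: "path set \<Rightarrow> path \<Rightarrow> nat \<Rightarrow> (nat \<Rightarrow> path \<Rightarrow> real) set" where
  "strategies \<S> S j =
    {H. \<forall>i\<ge>j. \<forall>X\<in>node \<S> S j. \<forall>Y\<in>node \<S> S j.
          (\<forall>k. j \<le> k \<and> k \<le> i \<longrightarrow> X k = Y k) \<longrightarrow> H i X = H i Y}"

definition portfolio :: "real \<Rightarrow> (nat \<Rightarrow> path \<Rightarrow> real) \<Rightarrow> nat \<Rightarrow> nat \<Rightarrow> path \<Rightarrow> real" where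
  "portfolio V H j n X = V + (\<Sum>i=j..<n. H i X * (X (Suc i) - X i))"

text \<open>The portfolio values of \<open>V\<close>, \<open>H\<close> at all times \<open>n \<ge> j\<close> are non-negative elementary
  functions on the node \<open>(S, j)\<close>.\<close>

definition nonneg_portfolio ::
  "path set \<Rightarrow> path \<Rightarrow> nat \<Rightarrow> real \<Rightarrow> (nat \<Rightarrow> path \<Rightarrow> real) \<Rightarrow> bool" where
  "nonneg_portfolio \<S> S j V H \<longleftrightarrow>
    H \<in> strategies \<S> S j \<and> (\<forall>n\<ge>j. \<forall>X\<in>node \<S> S j. 0 \<le> portfolio V H j n X)"

definition liminf_portfolio :: "real \<Rightarrow> (nat \<Rightarrow> path \<Rightarrow> real) \<Rightarrow> nat \<Rightarrow> path \<Rightarrow> ereal" where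
  "liminf_portfolio V H j X = liminf (\<lambda>n. ereal (portfolio V H j n X))"

text \<open>
  In the three definitions below the families \<open>V\<close>, \<open>H\<close> indexed by \<open>m \<ge> 0\<close> play the role of
  \<open>V\<^sup>m\<close>, \<open>H\<^sup>m\<close> with \<open>m \<ge> 1\<close>.  For \<open>S \<in> \<S>\<close> all terms of the infinite series are non-negative
  (\<open>V m\<close> is the portfolio value at time \<open>j\<close>), so the series exist in the extended reals.
\<close>

definition sigma_bar_nat :: "path set \<Rightarrow> nat \<Rightarrow> (path \<Rightarrow> ereal) \<Rightarrow> path \<Rightarrow> ereal" where
  "sigma_bar_nat \<S> j f S =
    Inf {ereal V0 + (\<Sum>m. ereal (V m)) | V0 H0 n0 V H.
      H0 \<in> strategies \<S> S j \<and> j \<le> n0 \<and>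
      (\<forall>m. nonneg_portfolio \<S> S j (V m) (H m)) \<and>
      (\<forall>X\<in>node \<S> S j.
         f X \<le> ereal (portfolio V0 H0 j n0 X) + (\<Sum>m. liminf_portfolio (V m) (H m) j X))}"

definition sigma_bar :: "path set \<Rightarrow> enat \<Rightarrow> (path \<Rightarrow> ereal) \<Rightarrow> path \<Rightarrow> ereal" where
  "sigma_bar \<S> t f S = (case t of enat j \<Rightarrow> sigma_bar_nat \<S> j f S | \<infinity> \<Rightarrow> f S)"

definition I_bar :: "path set \<Rightarrow> nat \<Rightarrow> (path \<Rightarrow> ereal) \<Rightarrow> path \<Rightarrow> ereal" where
  "I_bar \<S> j f S =
    Inf {(\<Sum>m. ereal (V m)) | V H.
      (\<forall>m. nonneg_portfolio \<S> S j (V m) (H m)) \<and>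
      (\<forall>X\<in>node \<S> S j. f X \<le> (\<Sum>m. liminf_portfolio (V m) (H m) j X))}"

definition property_L :: "path set \<Rightarrow> path \<Rightarrow> nat \<Rightarrow> bool" where
  "property_L \<S> S j \<longleftrightarrow>
    (\<forall>V0 H0 n0 V H.
      H0 \<in> strategies \<S> S j \<longrightarrow> j \<le> n0 \<longrightarrow>
      (\<forall>m. nonneg_portfolio \<S> S j (V m) (H m)) \<longrightarrow>
      (\<forall>X\<in>node \<S> S j.
         ereal (portfolio V0 H0 j n0 X) \<le> (\<Sum>m. liminf_portfolio (V m) (H m) j X)) \<longrightarrow>
      ereal V0 \<le> (\<Sum>m. ereal (V m)))"

text \<open>
  All trajectories start at the same point, so \<open>node \<S> S 0 = \<S>\<close> for every \<open>S \<in> \<S>\<close>.  Hence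
  \<open>I_bar \<S> 0 f S\<close> and \<open>property_L \<S> S 0\<close> do not depend on \<open>S \<in> \<S>\<close>, and the quantifiers over
  \<open>S \<in> \<S>\<close> at time 0 below merely name this common value.
\<close>

definition path_null :: "path set \<Rightarrow> path set \<Rightarrow> bool" where
  "path_null \<S> E \<longleftrightarrow> E \<subseteq> \<S> \<and> (\<forall>S\<in>\<S>. I_bar \<S> 0 (indicator E) S = 0)"

definition holds_ae :: "path set \<Rightarrow> (path \<Rightarrow> bool) \<Rightarrow> bool" where
  "holds_ae \<S> p \<longleftrightarrow> (\<exists>E. path_null \<S> E \<and> (\<forall>S\<in>\<S> - E. p S))"

definition L_ae :: "path set \<Rightarrow> bool" where
  "L_ae \<S> \<longleftrightarrow>
    (\<forall>S\<in>\<S>. property_L \<S> S 0) \<and> path_null \<S> {S \<in> \<S>. \<exists>j. \<not> property_L \<S> S j}"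

definition up_down_node :: "path set \<Rightarrow> path \<Rightarrow> nat \<Rightarrow> bool" where
  "up_down_node \<S> S j \<longleftrightarrow>
    (\<exists>S1\<in>node \<S> S j. \<exists>S2\<in>node \<S> S j. S1 (Suc j) < S j \<and> S j < S2 (Suc j))"

definition property_P :: "path set \<Rightarrow> bool" where
  "property_P \<S> \<longleftrightarrow>
    (\<forall>S\<in>\<S>. \<forall>k. up_down_node \<S> S k \<and> property_L \<S> S k \<and> \<not> property_L \<S> S (Suc k) \<longrightarrow>
      (\<exists>S1\<in>node \<S> S k. \<exists>S2\<in>node \<S> S k.
         S1 (Suc k) > S (Suc k) \<and> S (Suc k) > S2 (Suc k) \<and>
         property_L \<S> S1 (Suc k) \<and> property_L \<S> S2 (Suc k)))"

definition nonanticipative :: "path set \<Rightarrow> enat \<Rightarrow> (nat \<Rightarrow> path \<Rightarrow> ereal) \<Rightarrow> bool" where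
  "nonanticipative \<S> T f \<longleftrightarrow>
    (\<forall>j. enat j < T + 1 \<longrightarrow> (\<forall>S\<in>\<S>. \<forall>X\<in>node \<S> S j. f j X = f j S))"

definition supermartingale :: "path set \<Rightarrow> enat \<Rightarrow> (nat \<Rightarrow> path \<Rightarrow> ereal) \<Rightarrow> bool" where
  "supermartingale \<S> T f \<longleftrightarrow>
    nonanticipative \<S> T f \<and>
    (\<forall>j. enat j < T \<longrightarrow> holds_ae \<S> (\<lambda>S. sigma_bar \<S> (enat j) (f (Suc j)) S \<le> f j S))"

definition stopping_time :: "path set \<Rightarrow> (path \<Rightarrow> enat) \<Rightarrow> bool" where
  "stopping_time \<S> \<tau> \<longleftrightarrow>
    (\<forall>S\<in>\<S>. \<forall>S'\<in>\<S>. (\<forall>k. enat k \<le> \<tau> S \<longrightarrow> S k = S' k) \<longrightarrow> \<tau> S = \<tau> S')"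

definition extend_process ::
  "enat \<Rightarrow> (nat \<Rightarrow> path \<Rightarrow> ereal) \<Rightarrow> nat \<Rightarrow> path \<Rightarrow> ereal" where
  "extend_process T f j = (if enat j < T + 1 then f j else f (the_enat T))"

definition process_at ::
  "enat \<Rightarrow> (nat \<Rightarrow> path \<Rightarrow> ereal) \<Rightarrow> enat \<Rightarrow> path \<Rightarrow> ereal" where
  "process_at T f t S =
    (case t of enat j \<Rightarrow> extend_process T f j S
             | \<infinity> \<Rightarrow> liminf (\<lambda>n. extend_process T f n S))"

definition sigma_bar_at ::
  "path set \<Rightarrow> (path \<Rightarrow> enat) \<Rightarrow> (path \<Rightarrow> ereal) \<Rightarrow> path \<Rightarrow> ereal" where
  "sigma_bar_at \<S> \<tau> g S = sigma_bar \<S> (\<tau> S) g S"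

definition stopped_process ::
  "enat \<Rightarrow> (nat \<Rightarrow> path \<Rightarrow> ereal) \<Rightarrow> (path \<Rightarrow> enat) \<Rightarrow> path \<Rightarrow> ereal" where
  "stopped_process T f \<tau> S = process_at T f (\<tau> S) S"

end

theory Submission
  imports Defs "HOL-Library.Nat_Bijection"
begin

text \<open>
  At a node \<open>(X, i)\<close> where \<open>\<sigma>\<^sub>i f\<^sub>i\<^sub>+\<^sub>1 \<le> f\<^sub>i\<close>, property \<open>(L)\<close> at the successor nodes turns a nearly
  optimal superhedge of \<open>f\<^sub>i\<^sub>+\<^sub>1\<close> into a single number \<open>G\<close> with
  \<open>f\<^sub>i\<^sub>+\<^sub>1 Y \<le> f\<^sub>i X + \<epsilon> + G * (Y\<^sub>i\<^sub>+\<^sub>1 - X\<^sub>i)\<close>.  Starting at \<open>(S, j)\<close> with \<open>\<rho> S = j\<close>, trading these numbers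
  until \<open>\<tau>\<close> or until the path leaves the regular nodes gives a wealth process that dominates \<open>f\<close> up to
  \<open>\<tau>\<close> on regular paths.  It is non-negative on all paths: property \<open>(P)\<close> surrounds a successor where
  \<open>(L)\<close> fails by two successors where it holds, and the wealth is affine in the next price.
  The exceptional paths are null, and almost surely this persists conditionally at every later node,
  so they can be covered by \<open>\<infinity>\<close> at arbitrarily small cost.  For the second claim, the process
  \<open>1\<^bsub>{j < T + 1}\<^esub> f\<^sub>j\<close> is again a supermartingale.
\<close>

section \<open>Series of non-negative extended reals\<close>

text \<open>With non-negative terms it suffices to compare finite partial sums: finitely many codes
  decode into a rectangle, and the codes of a rectangle lie in an initial segment.\<close>

lemma suminf_ereal_2dimen:
  fixes F :: "nat \<Rightarrow> nat \<Rightarrow> ereal"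
  assumes nn: "\<And>k m. 0 \<le> F k m"
  shows "(\<Sum>n. case_prod F (prod_decode n)) = (\<Sum>k. \<Sum>m. F k m)"
proof (rule antisym)
  have nn': "0 \<le> case_prod F p" for p
    using nn by (cases p) auto
  have nn_row: "0 \<le> (\<Sum>m. F k m)" for k
    using nn by (intro suminf_0_le) auto
  show "(\<Sum>n. case_prod F (prod_decode n)) \<le> (\<Sum>k. \<Sum>m. F k m)"
  proof (rule suminf_bound)
    show "\<forall>N. (\<Sum>n<N. case_prod F (prod_decode n)) \<le> (\<Sum>k. \<Sum>m. F k m)"
    proof
      fix N
      let ?P = "prod_decode ` {..<N}"
      have fin: "finite ?P" by simp
      obtain K where K: "fst ` ?P \<subseteq> {..<K}"
        using finite_nat_iff_bounded[of "fst ` ?P"] fin by blast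
      obtain M where M: "snd ` ?P \<subseteq> {..<M}"
        using finite_nat_iff_bounded[of "snd ` ?P"] fin by blast
      have sub: "?P \<subseteq> {..<K} \<times> {..<M}"
        using subset_fst_snd[of ?P] Sigma_mono[OF K M] by (rule order_trans)
      have "(\<Sum>n<N. case_prod F (prod_decode n)) = sum (case_prod F) ?P"
        by (subst sum.reindex) (auto intro: inj_prod_decode)
      also have "\<dots> \<le> sum (case_prod F) ({..<K} \<times> {..<M})"
        using sub nn' by (intro sum_mono2) auto
      also have "\<dots> = (\<Sum>k<K. \<Sum>m<M. F k m)"
        by (simp add: sum.cartesian_product)
      also have "\<dots> \<le> (\<Sum>k<K. \<Sum>m. F k m)"
        using nn by (intro sum_mono suminf_upper) auto
      also have "\<dots> \<le> (\<Sum>k. \<Sum>m. F k m)"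
        using nn_row by (intro suminf_upper) auto
      finally show "(\<Sum>n<N. case_prod F (prod_decode n)) \<le> (\<Sum>k. \<Sum>m. F k m)" .
    qed
  qed (use nn' in auto)
  show "(\<Sum>k. \<Sum>m. F k m) \<le> (\<Sum>n. case_prod F (prod_decode n))"
  proof (rule suminf_bound)
    show "\<forall>K. (\<Sum>k<K. \<Sum>m. F k m) \<le> (\<Sum>n. case_prod F (prod_decode n))"
    proof
      fix K
      have "(\<Sum>k<K. \<Sum>m. F k m) = (\<Sum>m. \<Sum>k<K. F k m)"
        using nn by (intro suminf_sum_ereal[symmetric]) auto
      also have "\<dots> \<le> (\<Sum>n. case_prod F (prod_decode n))"
      proof (rule suminf_bound)
        show "\<forall>M. (\<Sum>m<M. \<Sum>k<K. F k m) \<le> (\<Sum>n. case_prod F (prod_decode n))"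
        proof
          fix M
          let ?Q = "prod_encode ` ({..<K} \<times> {..<M})"
          have "finite ?Q" by simp
          then obtain N where N: "?Q \<subseteq> {..<N}"
            using finite_nat_iff_bounded by blast
          have "(\<Sum>m<M. \<Sum>k<K. F k m) = (\<Sum>k<K. \<Sum>m<M. F k m)"
            by (rule sum.swap)
          also have "\<dots> = sum (case_prod F) ({..<K} \<times> {..<M})"
            by (simp add: sum.cartesian_product)
          also have "\<dots> = (\<Sum>n\<in>?Q. case_prod F (prod_decode n))"
            by (subst sum.reindex) (auto intro: inj_prod_encode)
          also have "\<dots> \<le> (\<Sum>n<N. case_prod F (prod_decode n))"
            using N nn' by (intro sum_mono2) auto
          also have "\<dots> \<le> (\<Sum>n. case_prod F (prod_decode n))"
            using nn' by (intro suminf_upper) auto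
          finally show "(\<Sum>m<M. \<Sum>k<K. F k m) \<le> (\<Sum>n. case_prod F (prod_decode n))" .
        qed
      qed (use nn in \<open>auto intro: sum_nonneg\<close>)
      finally show "(\<Sum>k<K. \<Sum>m. F k m) \<le> (\<Sum>n. case_prod F (prod_decode n))" .
    qed
  qed (use nn_row in auto)
qed

lemma suminf_const_infinity: "0 < c \<Longrightarrow> (\<Sum>k::nat. ereal c) = \<infinity>"
  using summable_ereal[of "\<lambda>_. c"] by (auto simp: summable_const_iff)

text \<open>Splits a budget \<open>e\<close> among countably many hedges.\<close>

lemma suminf_scaled_half: "0 \<le> e \<Longrightarrow> (\<Sum>k. ereal (e * (1/2) ^ Suc k)) = ereal e"
  using sums_mult[OF power_half_series, of e]
  by (simp only: sums_ereal[symmetric] sums_iff mult_1_right)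

section \<open>Nodes and portfolios\<close>

lemma in_nodeI: "S \<in> \<S> \<Longrightarrow> S \<in> node \<S> S j"
  by (simp add: node_def)

lemma node_subset: "node \<S> S j \<subseteq> \<S>"
  by (auto simp: node_def)

lemma node_eqI: "X \<in> node \<S> S j \<Longrightarrow> node \<S> X j = node \<S> S j"
  by (auto simp: node_def)

lemma node_later: "X \<in> node \<S> S i \<Longrightarrow> i \<le> j \<Longrightarrow> node \<S> X j \<subseteq> node \<S> S i"
  by (auto simp: node_def)

lemma node_earlier: "Y \<in> node \<S> X n \<Longrightarrow> k \<le> n \<Longrightarrow> Y \<in> node \<S> X k"
  by (auto simp: node_def)

lemma node_zero: "trajectory_set s0 \<S> \<Longrightarrow> S \<in> \<S> \<Longrightarrow> node \<S> S 0 = \<S>"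
  unfolding node_def trajectory_set_def by (intro equalityI subsetI CollectI conjI) (auto, metis)

lemma strategiesD:
  assumes "H \<in> strategies \<S> S j" "j \<le> i" "X \<in> node \<S> S j" "Y \<in> node \<S> S j"
    and "\<And>k. j \<le> k \<Longrightarrow> k \<le> i \<Longrightarrow> X k = Y k"
  shows "H i X = H i Y"
proof -
  have "\<forall>i\<ge>j. \<forall>X\<in>node \<S> S j. \<forall>Y\<in>node \<S> S j.
      (\<forall>k. j \<le> k \<and> k \<le> i \<longrightarrow> X k = Y k) \<longrightarrow> H i X = H i Y"
    using assms(1) unfolding strategies_def by (rule CollectD)
  then show ?thesis by (rule rev_mp) (use assms(2-5) in blast)
qed

text \<open>Paths of the later node already agree up to time \<open>j\<close>, so agreement from
  \<open>j\<close> on gives agreement from \<open>i\<close> on.\<close>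

lemma strategies_later:
  assumes "H \<in> strategies \<S> S i" "X \<in> node \<S> S i" "i \<le> j"
  shows "H \<in> strategies \<S> X j"
  unfolding strategies_def
proof (intro CollectI allI impI ballI)
  fix k Y Z
  assume k: "j \<le> k" and Y: "Y \<in> node \<S> X j" and Z: "Z \<in> node \<S> X j"
    and eq: "\<forall>l. j \<le> l \<and> l \<le> k \<longrightarrow> Y l = Z l"
  have "Y l = Z l" if "l \<le> k" for l
    using Y Z eq that by (cases "l \<le> j") (auto simp: node_def)
  moreover have "Y \<in> node \<S> S i" "Z \<in> node \<S> S i"
    using node_later[OF assms(2,3)] Y Z by auto
  ultimately show "H k Y = H k Z"
    using strategiesD[OF assms(1)] assms(3) k by (meson le_trans)
qed

text \<open>Here and in the next lemmas, the base path enters only through its node, or through a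
  price fixed on that node, so any other path of the node can replace it.\<close>

lemma strategies_node_eq: "X \<in> node \<S> S j \<Longrightarrow> strategies \<S> X j = strategies \<S> S j"
  unfolding strategies_def by (simp only: node_eqI)

lemma property_L_node_eq: "X \<in> node \<S> S j \<Longrightarrow> property_L \<S> X j = property_L \<S> S j"
  unfolding property_L_def nonneg_portfolio_def by (simp only: strategies_node_eq node_eqI)

lemma sigma_bar_nat_node_eq:
  "X \<in> node \<S> S j \<Longrightarrow> sigma_bar_nat \<S> j f X = sigma_bar_nat \<S> j f S"
  unfolding sigma_bar_nat_def nonneg_portfolio_def by (simp only: strategies_node_eq node_eqI)

lemma up_down_node_eq: "X \<in> node \<S> S j \<Longrightarrow> up_down_node \<S> X j = up_down_node \<S> S j"
  unfolding up_down_node_def by (simp only: node_eqI) (simp add: node_def)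

lemma sigma_bar_nat_mono:
  assumes "\<And>X. X \<in> node \<S> S j \<Longrightarrow> f X \<le> g X"
  shows "sigma_bar_nat \<S> j f S \<le> sigma_bar_nat \<S> j g S"
  unfolding sigma_bar_nat_def
proof (rule Inf_superset_mono, safe)
  fix V0 H0 n0 V H
  assume "H0 \<in> strategies \<S> S j" "j \<le> n0" "\<forall>m. nonneg_portfolio \<S> S j (V m) (H m)"
    and "\<forall>X\<in>node \<S> S j. g X \<le> ereal (portfolio V0 H0 j n0 X) +
           (\<Sum>m. liminf_portfolio (V m) (H m) j X)"
  moreover from this(4) have "\<forall>X\<in>node \<S> S j. f X \<le> ereal (portfolio V0 H0 j n0 X) +
           (\<Sum>m. liminf_portfolio (V m) (H m) j X)"
    using assms order_trans by fast
  ultimately show "\<exists>V0' H0' n0' V' H'. ereal V0 + (\<Sum>m. ereal (V m)) =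
      ereal V0' + (\<Sum>m. ereal (V' m)) \<and> H0' \<in> strategies \<S> S j \<and> j \<le> n0' \<and>
      (\<forall>m. nonneg_portfolio \<S> S j (V' m) (H' m)) \<and>
      (\<forall>X\<in>node \<S> S j. f X \<le> ereal (portfolio V0' H0' j n0' X) +
         (\<Sum>m. liminf_portfolio (V' m) (H' m) j X))"
    by (intro exI conjI) (rule refl | assumption)+
qed

lemma strategies_adapted:
  assumes "H \<in> strategies \<S> S j" "X \<in> node \<S> S j" "Y \<in> node \<S> X i" "j \<le> i"
  shows "H i Y = H i X"
proof -
  have "Y \<in> node \<S> S j" "\<forall>k. j \<le> k \<and> k \<le> i \<longrightarrow> Y k = X k"
    using assms(2-4) by (auto simp: node_def)
  then show ?thesis using strategiesD[OF assms(1,4)] assms(2) by blast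
qed

text \<open>Inside the node at time \<open>j\<close>, agreeing on the times from \<open>j\<close> to
  \<open>i\<close> means lying in the same node at time \<open>i\<close>. Non-anticipation can thus
  be checked as constancy on nodes, as in \<open>strategies_adapted\<close>.\<close>

lemma strategiesI:
  assumes "\<And>i X Y. j \<le> i \<Longrightarrow> X \<in> node \<S> S j \<Longrightarrow> Y \<in> node \<S> X i \<Longrightarrow> H i Y = H i X"
  shows "H \<in> strategies \<S> S j"
  unfolding strategies_def
proof (intro CollectI allI impI ballI)
  fix i X Y
  assume i: "j \<le> i" and X: "X \<in> node \<S> S j" and Y: "Y \<in> node \<S> S j"
    and eq: "\<forall>k. j \<le> k \<and> k \<le> i \<longrightarrow> X k = Y k"
  have "X k = Y k" if "k \<le> i" for k
    using X Y eq that by (cases "k \<le> j") (auto simp: node_def)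
  then have "X \<in> node \<S> Y i" using X by (simp add: node_def)
  then show "H i X = H i Y" using assms[OF i Y] by blast
qed

lemma strategies_compose:
  "H \<in> strategies \<S> S j \<Longrightarrow> (\<lambda>i X. g i (H i X)) \<in> strategies \<S> S j"
  by (rule strategiesI) (metis strategies_adapted)

lemma portfolio_start [simp]: "portfolio V H j j X = V"
  by (simp add: portfolio_def)

lemma portfolio_step:
  "j \<le> n \<Longrightarrow> portfolio V H j (Suc n) X = portfolio V H j n X + H n X * (X (Suc n) - X n)"
  by (simp add: portfolio_def)

lemma portfolio_concat:
  "i \<le> j \<Longrightarrow> j \<le> n \<Longrightarrow> portfolio (portfolio V H i j X) H j n X = portfolio V H i n X"
  by (simp add: portfolio_def sum.atLeastLessThan_concat)

lemma portfolio_scale: "portfolio (c * V) (\<lambda>i X. c * H i X) j n X = c * portfolio V H j n X"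
  by (simp add: portfolio_def algebra_simps sum_distrib_left)

text \<open>Wealth at time \<open>j\<close> uses only positions taken before \<open>j\<close> and
  prices up to \<open>j\<close>, and these are constant on the node at time
  \<open>j\<close>.\<close>

lemma portfolio_node:
  assumes "H \<in> strategies \<S> S i" "Y \<in> node \<S> S i" "X \<in> node \<S> Y j" "i \<le> j"
  shows "portfolio V H i j X = portfolio V H i j Y"
proof -
  have "H k X * (X (Suc k) - X k) = H k Y * (Y (Suc k) - Y k)" if "k \<in> {i..<j}" for k
  proof -
    have "X \<in> node \<S> Y k" using assms(3) that by (auto simp: node_def)
    then have "H k X = H k Y" using strategies_adapted[OF assms(1,2)] that by auto
    then show ?thesis using assms(3) that by (auto simp: node_def)
  qed
  then show ?thesis by (simp add: portfolio_def)
qed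

lemma nonneg_portfolio_start:
  "nonneg_portfolio \<S> S j V H \<Longrightarrow> S \<in> \<S> \<Longrightarrow> 0 \<le> V"
  using in_nodeI[of S \<S> j] by (force simp: nonneg_portfolio_def)

lemma liminf_portfolio_nonneg:
  assumes "nonneg_portfolio \<S> S j V H" "X \<in> node \<S> S j"
  shows "0 \<le> liminf_portfolio V H j X"
  unfolding liminf_portfolio_def
proof (rule Liminf_bounded)
  show "\<forall>\<^sub>F n in sequentially. 0 \<le> ereal (portfolio V H j n X)"
    using assms by (intro eventually_sequentiallyI[of j]) (auto simp: nonneg_portfolio_def)
qed

text \<open>Continuing from the wealth accumulated by time \<open>j\<close> reproduces the original
  wealth at all later times.\<close>

lemma nonneg_portfolio_restart:
  assumes "nonneg_portfolio \<S> S i V H" "Y \<in> node \<S> S i" "i \<le> j"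
  shows "nonneg_portfolio \<S> Y j (portfolio V H i j Y) H"
  unfolding nonneg_portfolio_def
proof (intro conjI allI impI ballI)
  have H: "H \<in> strategies \<S> S i" using assms(1) by (simp add: nonneg_portfolio_def)
  then show "H \<in> strategies \<S> Y j" using assms strategies_later by blast
  fix n X assume n: "j \<le> n" and X: "X \<in> node \<S> Y j"
  have "portfolio (portfolio V H i j Y) H j n X = portfolio V H i n X"
    using portfolio_concat[of i j n] portfolio_node[OF H assms(2) X assms(3)] n assms(3) by metis
  then show "0 \<le> portfolio (portfolio V H i j Y) H j n X"
    using assms n node_later[OF assms(2,3)] X by (auto simp: nonneg_portfolio_def)
qed

lemma liminf_portfolio_restart:
  assumes "H \<in> strategies \<S> S i" "Y \<in> node \<S> S i" "X \<in> node \<S> Y j" "i \<le> j"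
  shows "liminf_portfolio (portfolio V H i j Y) H j X = liminf_portfolio V H i X"
  unfolding liminf_portfolio_def
proof (rule Liminf_eq, rule eventually_sequentiallyI[of j])
  fix n assume "j \<le> n"
  then show "ereal (portfolio (portfolio V H i j Y) H j n X) = ereal (portfolio V H i n X)"
    using portfolio_concat[of i j n] portfolio_node[OF assms] assms(4) by metis
qed

lemma nonneg_portfolio_scale:
  assumes "nonneg_portfolio \<S> S j V H" "0 \<le> c"
  shows "nonneg_portfolio \<S> S j (c * V) (\<lambda>i X. c * H i X)"
  using assms strategies_compose[of H \<S> S j "\<lambda>_. (*) c"]
  by (simp add: nonneg_portfolio_def portfolio_scale)

lemma liminf_portfolio_scale:
  "0 \<le> c \<Longrightarrow> liminf_portfolio (c * V) (\<lambda>i X. c * H i X) j X = ereal c * liminf_portfolio V H j X"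
  unfolding liminf_portfolio_def portfolio_scale
  by (simp add: Liminf_ereal_mult_left flip: times_ereal.simps(1))

lemma liminf_portfolio_finite_horizon:
  assumes "j \<le> n" "\<And>i. n \<le> i \<Longrightarrow> H i X = 0"
  shows "liminf_portfolio V H j X = ereal (portfolio V H j n X)"
proof -
  have "portfolio V H j k X = portfolio V H j n X" if "n \<le> k" for k
    using that
    by (induction k rule: dec_induct) (use assms in \<open>auto simp: portfolio_step\<close>)
  then have "liminf_portfolio V H j X = liminf (\<lambda>_. ereal (portfolio V H j n X))"
    unfolding liminf_portfolio_def
    by (intro Liminf_eq eventually_sequentiallyI[of n] arg_cong[where f = ereal])
  then show ?thesis by (simp add: Liminf_const)
qed

section \<open>Superhedging and null sets\<close>

text \<open>Hedges as in \<open>I_bar\<close>, but with an explicit real budget \<open>c\<close>.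
  Working with budgets avoids handling the infimum, which need not be attained.\<close>

definition superhedgeable :: "path set \<Rightarrow> path \<Rightarrow> nat \<Rightarrow> real \<Rightarrow> (path \<Rightarrow> ereal) \<Rightarrow> bool" where
  "superhedgeable \<S> S j c g \<longleftrightarrow> (\<exists>V H. (\<forall>m. nonneg_portfolio \<S> S j (V m) (H m)) \<and>
     (\<Sum>m. ereal (V m)) \<le> ereal c \<and>
     (\<forall>X\<in>node \<S> S j. g X \<le> (\<Sum>m. liminf_portfolio (V m) (H m) j X)))"

lemma superhedgeableI:
  assumes "\<And>m. nonneg_portfolio \<S> S j (V m) (H m)" "(\<Sum>m. ereal (V m)) \<le> ereal c"
    and "\<And>X. X \<in> node \<S> S j \<Longrightarrow> g X \<le> (\<Sum>m. liminf_portfolio (V m) (H m) j X)"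
  shows "superhedgeable \<S> S j c g"
  unfolding superhedgeable_def
  by (rule exI[of _ V], rule exI[of _ H]) (use assms in simp)

lemma superhedgeableE:
  assumes "superhedgeable \<S> S j c g"
  obtains V H where "\<And>m. nonneg_portfolio \<S> S j (V m) (H m)" "(\<Sum>m. ereal (V m)) \<le> ereal c"
    "\<And>X. X \<in> node \<S> S j \<Longrightarrow> g X \<le> (\<Sum>m. liminf_portfolio (V m) (H m) j X)"
proof -
  obtain V H where "(\<forall>m. nonneg_portfolio \<S> S j (V m) (H m)) \<and>
     (\<Sum>m. ereal (V m)) \<le> ereal c \<and>
     (\<forall>X\<in>node \<S> S j. g X \<le> (\<Sum>m. liminf_portfolio (V m) (H m) j X))"
    using assms unfolding superhedgeable_def by (elim exE)
  then show thesis by (intro that[of V H]) simp_all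
qed

lemma superhedgeable_mono:
  assumes "superhedgeable \<S> S j c g" "\<And>X. X \<in> node \<S> S j \<Longrightarrow> h X \<le> g X"
  shows "superhedgeable \<S> S j c h"
  using assms(1)
proof (rule superhedgeableE)
  fix V H
  assume VH: "\<And>m. nonneg_portfolio \<S> S j (V m) (H m)" "(\<Sum>m. ereal (V m)) \<le> ereal c"
    "\<And>X. X \<in> node \<S> S j \<Longrightarrow> g X \<le> (\<Sum>m. liminf_portfolio (V m) (H m) j X)"
  show ?thesis
    by (rule superhedgeableI[where V = V and H = H]) (use VH assms(2) order_trans in blast)+
qed

lemma superhedgeable_node_eq:
  "X \<in> node \<S> S j \<Longrightarrow> superhedgeable \<S> X j c g = superhedgeable \<S> S j c g"
  unfolding superhedgeable_def nonneg_portfolio_def by (simp only: strategies_node_eq node_eqI)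

lemma nonneg_portfolio_const: "0 \<le> c \<Longrightarrow> nonneg_portfolio \<S> S j c (\<lambda>i X. 0)"
  by (simp add: nonneg_portfolio_def portfolio_def strategies_def)

text \<open>The single portfolio is padded with zero portfolios to a sequence.\<close>

lemma superhedgeable_portfolio:
  assumes "nonneg_portfolio \<S> S j V H"
  shows "superhedgeable \<S> S j V (liminf_portfolio V H j)"
proof (rule superhedgeableI)
  let ?V = "\<lambda>m::nat. if m = 0 then V else 0" and ?H = "\<lambda>m::nat. if m = 0 then H else (\<lambda>i X. 0)"
  show "nonneg_portfolio \<S> S j (?V m) (?H m)" for m
    using assms by (cases "m = 0") (simp_all add: nonneg_portfolio_const)
  have "(\<Sum>m. ereal (?V m)) = (\<Sum>m\<in>{0}. ereal (?V m))"
    by (rule suminf_finite) auto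
  then show "(\<Sum>m. ereal (?V m)) \<le> ereal V" by simp
  fix X
  have "(\<Sum>m. liminf_portfolio (?V m) (?H m) j X) = (\<Sum>m\<in>{0}. liminf_portfolio (?V m) (?H m) j X)"
    by (rule suminf_finite) (auto simp: liminf_portfolio_def portfolio_def Liminf_const)
  then show "liminf_portfolio V H j X \<le> (\<Sum>m. liminf_portfolio (?V m) (?H m) j X)" by simp
qed

lemma superhedgeable_const: "0 \<le> c \<Longrightarrow> superhedgeable \<S> S j c (\<lambda>X. ereal c)"
  by (rule superhedgeable_mono[OF superhedgeable_portfolio[OF nonneg_portfolio_const]])
    (simp_all add: liminf_portfolio_def portfolio_def Liminf_const)

text \<open>A hedge is chosen for each \<open>k\<close>, and the resulting double family is
  enumerated by \<open>prod_decode\<close>. Since \<open>S \<in> \<S>\<close>, the node is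
  non-empty, which makes all initial capitals non-negative and permits rearranging the
  costs.\<close>

lemma superhedgeable_suminf:
  assumes S: "S \<in> \<S>" and hedge: "\<And>k::nat. superhedgeable \<S> S j (c k) (g k)"
    and nn: "\<And>k X. X \<in> node \<S> S j \<Longrightarrow> 0 \<le> g k X"
    and cost: "(\<Sum>k. ereal (c k)) \<le> ereal e"
  shows "superhedgeable \<S> S j e (\<lambda>X. \<Sum>k. g k X)"
proof -
  have "\<forall>k. \<exists>V H. (\<forall>m. nonneg_portfolio \<S> S j (V m) (H m)) \<and>
      (\<Sum>m. ereal (V m)) \<le> ereal (c k) \<and>
      (\<forall>X\<in>node \<S> S j. g k X \<le> (\<Sum>m. liminf_portfolio (V m) (H m) j X))"
    using hedge unfolding superhedgeable_def by (rule allI)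
  then obtain V where "\<forall>k. \<exists>H. (\<forall>m. nonneg_portfolio \<S> S j (V k m) (H m)) \<and>
      (\<Sum>m. ereal (V k m)) \<le> ereal (c k) \<and>
      (\<forall>X\<in>node \<S> S j. g k X \<le> (\<Sum>m. liminf_portfolio (V k m) (H m) j X))"
    by (rule choice[THEN exE])
  then obtain H where VH: "\<forall>k. (\<forall>m. nonneg_portfolio \<S> S j (V k m) (H k m)) \<and>
      (\<Sum>m. ereal (V k m)) \<le> ereal (c k) \<and>
      (\<forall>X\<in>node \<S> S j. g k X \<le> (\<Sum>m. liminf_portfolio (V k m) (H k m) j X))"
    by (rule choice[THEN exE])
  have nonneg: "nonneg_portfolio \<S> S j (V k m) (H k m)"
    and c: "(\<Sum>m. ereal (V k m)) \<le> ereal (c k)"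
    and payoff: "X \<in> node \<S> S j \<Longrightarrow> g k X \<le> (\<Sum>m. liminf_portfolio (V k m) (H k m) j X)"
    for k m X
    using VH by simp_all
  let ?V = "\<lambda>n. case_prod V (prod_decode n)" and ?H = "\<lambda>n. case_prod H (prod_decode n)"
  have V0: "0 \<le> V k m" for k m using nonneg_portfolio_start[OF nonneg S] .
  show ?thesis
  proof (rule superhedgeableI)
    show "nonneg_portfolio \<S> S j (?V m) (?H m)" for m
      using nonneg by (simp split: prod.split)
    have "(\<Sum>m. ereal (?V m)) = (\<Sum>m. case_prod (\<lambda>k m. ereal (V k m)) (prod_decode m))"
      by (intro suminf_cong) (simp split: prod.split)
    also have "\<dots> = (\<Sum>k. \<Sum>m. ereal (V k m))"
      using V0 by (intro suminf_ereal_2dimen) simp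
    also have "\<dots> \<le> (\<Sum>k. ereal (c k))"
      using c V0 by (intro suminf_le_pos suminf_0_le) simp_all
    finally show "(\<Sum>m. ereal (?V m)) \<le> ereal e" using cost by (rule order_trans)
    fix X assume X: "X \<in> node \<S> S j"
    have "(\<Sum>k. g k X) \<le> (\<Sum>k. \<Sum>m. liminf_portfolio (V k m) (H k m) j X)"
      using payoff[OF X] nn[OF X] by (intro suminf_le_pos)
    also have "\<dots> = (\<Sum>n. case_prod (\<lambda>k m. liminf_portfolio (V k m) (H k m) j X) (prod_decode n))"
      by (rule suminf_ereal_2dimen[symmetric]) (rule liminf_portfolio_nonneg[OF nonneg X])
    also have "\<dots> = (\<Sum>m. liminf_portfolio (?V m) (?H m) j X)"
      by (intro suminf_cong) (simp split: prod.split)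
    finally show "(\<Sum>k. g k X) \<le> (\<Sum>m. liminf_portfolio (?V m) (?H m) j X)" .
  qed
qed

lemma superhedgeable_add:
  assumes S: "S \<in> \<S>" and f: "superhedgeable \<S> S j a f" and g: "superhedgeable \<S> S j b g"
    and nn: "\<And>X. X \<in> node \<S> S j \<Longrightarrow> 0 \<le> f X \<and> 0 \<le> g X"
  shows "superhedgeable \<S> S j (a + b) (\<lambda>X. f X + g X)"
proof -
  let ?c = "\<lambda>k::nat. if k = 0 then a else if k = 1 then b else 0"
  let ?h = "\<lambda>k::nat. if k = 0 then f else if k = 1 then g else (\<lambda>_. 0)"
  have "superhedgeable \<S> S j 0 (\<lambda>X. 0)"
    using superhedgeable_const[of 0 \<S> S j] by (simp add: zero_ereal_def)
  then have hedge: "superhedgeable \<S> S j (?c k) (?h k)" for k using f g by simp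
  have "(\<Sum>k. ereal (?c k)) = (\<Sum>k\<in>{0,1}. ereal (?c k))"
    by (rule suminf_finite) simp_all
  then have "superhedgeable \<S> S j (a + b) (\<lambda>X. \<Sum>k. ?h k X)"
    using nn by (intro superhedgeable_suminf[OF S hedge]) simp_all
  moreover have "(\<Sum>k. ?h k X) = f X + g X" for X
  proof -
    have "(\<Sum>k. ?h k X) = (\<Sum>k\<in>{0,1}. ?h k X)" by (rule suminf_finite) simp_all
    then show ?thesis by simp
  qed
  ultimately show ?thesis by simp
qed

text \<open>Such a hedge is admissible for the conditional operator, with the zero portfolio as
  elementary part.\<close>

lemma sigma_bar_nat_le:
  assumes "superhedgeable \<S> S j c g"
  shows "sigma_bar_nat \<S> j g S \<le> ereal c"
  using assms
proof (rule superhedgeableE)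
  fix V H
  assume VH: "\<And>m. nonneg_portfolio \<S> S j (V m) (H m)" "(\<Sum>m. ereal (V m)) \<le> ereal c"
    "\<And>X. X \<in> node \<S> S j \<Longrightarrow> g X \<le> (\<Sum>m. liminf_portfolio (V m) (H m) j X)"
  have "sigma_bar_nat \<S> j g S \<le> ereal 0 + (\<Sum>m. ereal (V m))"
    unfolding sigma_bar_nat_def
    by (rule Inf_lower, rule CollectI, rule exI[of _ 0], rule exI[of _ "\<lambda>i X. 0"],
        rule exI[of _ j], rule exI[of _ V], rule exI[of _ H])
      (use VH in \<open>simp add: strategies_def\<close>)
  then show ?thesis using VH(2) by simp
qed

lemma superhedgeable_if_I_bar_less:
  assumes "I_bar \<S> j g S < ereal c"
  shows "superhedgeable \<S> S j c g"
  using assms unfolding I_bar_def Inf_less_iff superhedgeable_def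
  by (elim bexE CollectE exE conjE) (intro exI conjI, assumption, simp, assumption)

lemma I_bar_le:
  assumes "superhedgeable \<S> S j c g"
  shows "I_bar \<S> j g S \<le> ereal c"
  using assms
proof (rule superhedgeableE)
  fix V H
  assume VH: "\<And>m. nonneg_portfolio \<S> S j (V m) (H m)" "(\<Sum>m. ereal (V m)) \<le> ereal c"
    "\<And>X. X \<in> node \<S> S j \<Longrightarrow> g X \<le> (\<Sum>m. liminf_portfolio (V m) (H m) j X)"
  have "I_bar \<S> j g S \<le> (\<Sum>m. ereal (V m))"
    unfolding I_bar_def
    by (rule Inf_lower, rule CollectI, rule exI[of _ V], rule exI[of _ H]) (use VH in simp)
  then show ?thesis using VH(2) by simp
qed

section \<open>Null sets, global and conditional on a node\<close>

text \<open>Nullity conditional on the node. The payoff is infinite on \<open>E\<close>, so that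
  adding such a hedge makes every required inequality hold on \<open>E\<close> at arbitrarily small
  cost.\<close>

definition null_at :: "path set \<Rightarrow> path \<Rightarrow> nat \<Rightarrow> path set \<Rightarrow> bool" where
  "null_at \<S> S j E \<longleftrightarrow> (\<forall>e>0. superhedgeable \<S> S j e (\<lambda>X. if X \<in> E then \<infinity> else 0))"

text \<open>The \<open>k\<close>-th set is hedged with budget \<open>e / 2 ^ Suc k\<close>, and the
  hedges are added.\<close>

lemma null_at_UN:
  assumes S: "S \<in> \<S>" and null: "\<And>k::nat. null_at \<S> S j (E k)"
  shows "null_at \<S> S j (\<Union>k. E k)"
  unfolding null_at_def
proof (intro allI impI)
  fix e :: real assume e: "e > 0"
  let ?g = "\<lambda>k X. if X \<in> E k then \<infinity> else 0 :: ereal"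
  have "superhedgeable \<S> S j (e * (1/2) ^ Suc k) (?g k)" for k
    using null[of k] e unfolding null_at_def by simp
  then have "superhedgeable \<S> S j e (\<lambda>X. \<Sum>k. ?g k X)"
    by (rule superhedgeable_suminf[OF S]) (use e suminf_scaled_half[of e] in simp_all)
  then show "superhedgeable \<S> S j e (\<lambda>X. if X \<in> (\<Union>k. E k) then \<infinity> else 0)"
  proof (rule superhedgeable_mono)
    fix X
    have "(\<Sum>k. ?g k X) = \<infinity>" if "X \<in> E k" for k
    proof (rule ccontr)
      assume "(\<Sum>k. ?g k X) \<noteq> \<infinity>"
      then have "?g k X \<noteq> \<infinity>" by (intro suminf_PInfty[of "\<lambda>k. ?g k X" k]) simp_all
      then show False using that by simp
    qed
    moreover have "0 \<le> (\<Sum>k. ?g k X)" by (rule suminf_0_le) simp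
    ultimately show "(if X \<in> (\<Union>k. E k) then \<infinity> else 0) \<le> (\<Sum>k. ?g k X)" by auto
  qed
qed

text \<open>Adding infinitely many hedges of the indicator, with geometrically decreasing costs,
  pays infinity on \<open>E\<close>. Conversely the infinite payoff dominates the indicator, and no
  hedge has negative cost.\<close>

lemma path_null_iff_null_at:
  assumes "E \<subseteq> \<S>"
  shows "path_null \<S> E \<longleftrightarrow> (\<forall>S\<in>\<S>. null_at \<S> S 0 E)"
proof
  assume null: "path_null \<S> E"
  show "\<forall>S\<in>\<S>. null_at \<S> S 0 E"
    unfolding null_at_def
  proof (intro ballI allI impI)
    fix S and e :: real assume S: "S \<in> \<S>" and e: "e > 0"
    have hedge: "superhedgeable \<S> S 0 (e * (1/2) ^ Suc k) (indicator E)" for k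
      using null S e by (intro superhedgeable_if_I_bar_less) (simp add: path_null_def)
    have "superhedgeable \<S> S 0 e (\<lambda>X. \<Sum>k::nat. indicator E X)"
      by (rule superhedgeable_suminf[OF S, where c = "\<lambda>k. e * (1/2) ^ Suc k"], rule hedge)
        (use e suminf_scaled_half[of e] in \<open>simp_all add: indicator_def\<close>)
    then show "superhedgeable \<S> S 0 e (\<lambda>X. if X \<in> E then \<infinity> else 0)"
    proof (rule superhedgeable_mono)
      fix X
      have "(\<Sum>k::nat. 1 :: ereal) = \<infinity>"
        using suminf_const_infinity[of 1] by (simp add: one_ereal_def)
      moreover have "0 \<le> (\<Sum>k::nat. indicator E X :: ereal)"
        by (rule suminf_0_le) (simp add: indicator_def)
      ultimately show "(if X \<in> E then \<infinity> else 0) \<le> (\<Sum>k::nat. indicator E X :: ereal)" by auto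
    qed
  qed
next
  assume null: "\<forall>S\<in>\<S>. null_at \<S> S 0 E"
  show "path_null \<S> E"
    unfolding path_null_def
  proof (intro conjI ballI antisym)
    fix S assume S: "S \<in> \<S>"
    show "I_bar \<S> 0 (indicator E) S \<le> 0"
    proof (rule ereal_le_epsilon2)
      fix e :: real assume "0 < e"
      then have "superhedgeable \<S> S 0 e (\<lambda>X. if X \<in> E then \<infinity> else 0)"
        using null S unfolding null_at_def by simp
      then have "superhedgeable \<S> S 0 e (indicator E)"
        by (rule superhedgeable_mono) simp
      then show "I_bar \<S> 0 (indicator E) S \<le> 0 + ereal e" using I_bar_le by simp
    qed
    show "0 \<le> I_bar \<S> 0 (indicator E) S"
      unfolding I_bar_def
    proof (rule Inf_greatest, clarify)
      fix V :: "nat \<Rightarrow> real" and H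
      assume "\<forall>m. nonneg_portfolio \<S> S 0 (V m) (H m)"
      then have "0 \<le> ereal (V m)" for m using nonneg_portfolio_start S by fastforce
      then show "0 \<le> (\<Sum>m. ereal (V m))" by (intro suminf_0_le)
    qed
  qed (fact assms)
qed

lemma path_null_UN:
  assumes null: "\<And>k::nat. path_null \<S> (E k)"
  shows "path_null \<S> (\<Union>k. E k)"
proof -
  have sub: "E k \<subseteq> \<S>" for k using null[of k] by (simp add: path_null_def)
  then have "\<forall>S\<in>\<S>. null_at \<S> S 0 (E k)" for k
    using null[of k] path_null_iff_null_at by simp
  then have "\<forall>S\<in>\<S>. null_at \<S> S 0 (\<Union>k. E k)"
    using null_at_UN by simp
  moreover have "(\<Union>k. E k) \<subseteq> \<S>" using sub by (rule UN_least)
  ultimately show ?thesis using path_null_iff_null_at by simp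
qed

lemma path_null_Un:
  assumes "path_null \<S> E" "path_null \<S> F"
  shows "path_null \<S> (E \<union> F)"
proof -
  have "path_null \<S> (\<Union>k::nat. if k = 0 then E else F)"
    using assms by (intro path_null_UN) simp
  also have "(\<Union>k::nat. if k = 0 then E else F) = E \<union> F"
    by (auto split: if_splits)
  finally show ?thesis .
qed

text \<open>Positions are closed at time \<open>k\<close>, so the wealth stays frozen from then
  on.\<close>

lemma portfolio_stop:
  assumes "j \<le> n"
  shows "portfolio V (\<lambda>i X. if i < k then H i X else 0) j n X = portfolio V H j (min n k) X"
proof -
  have "(\<Sum>i=j..<n. (if i < k then H i X else 0) * (X (Suc i) - X i)) =
      (\<Sum>i=j..<min n k. H i X * (X (Suc i) - X i))"
    by (rule sum.mono_neutral_cong_right) auto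
  then show ?thesis by (simp add: portfolio_def)
qed

lemma strategies_stop:
  "H \<in> strategies \<S> S j \<Longrightarrow> (\<lambda>i X. if i < k then H i X else 0) \<in> strategies \<S> S j"
  using strategies_compose[of H \<S> S j "\<lambda>i x. if i < k then x else 0"] by simp

lemma nonneg_portfolio_stop:
  assumes "nonneg_portfolio \<S> S j V H" "j \<le> k"
  shows "nonneg_portfolio \<S> S j V (\<lambda>i X. if i < k then H i X else 0)"
  using assms strategies_stop[of H \<S> S j k]
  unfolding nonneg_portfolio_def by (simp add: portfolio_stop)

lemma liminf_portfolio_stop:
  assumes "j \<le> k"
  shows "liminf_portfolio V (\<lambda>i X. if i < k then H i X else 0) j X = ereal (portfolio V H j k X)"
  using liminf_portfolio_finite_horizon[OF assms, of "\<lambda>i X. if i < k then H i X else 0" X V]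
    portfolio_stop[OF assms, of V k H X] by simp

text \<open>
  A hedge of \<open>\<infinity> * 1\<^sub>E\<close> can be restarted at \<open>(S, j)\<close> with its current total value, which is then scaled
  down.  This fails only where that value is infinite, and these paths are covered by the same hedge
  stopped at time \<open>j\<close>.
\<close>

lemma null_at_almost_all_nodes:
  assumes traj: "trajectory_set s0 \<S>" and null: "path_null \<S> E"
  obtains N where "path_null \<S> N" "\<And>S j. S \<in> \<S> \<Longrightarrow> S \<notin> N \<Longrightarrow> null_at \<S> S j E"
proof (cases "\<S> = {}")
  case True
  then show ?thesis using that[of "{}"] by (simp add: path_null_def)
next
  case False
  then obtain R where R: "R \<in> \<S>" by blast
  have E: "E \<subseteq> \<S>" using null by (simp add: path_null_def)
  have root: "X \<in> node \<S> R 0" if "X \<in> \<S>" for X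
    using node_zero[OF traj R] that by simp
  \<comment> \<open>One fixed hedge of budget 1 serves all nodes and all \<open>e\<close>, since a
    multiple of an infinite payoff by a positive number is still infinite.\<close>
  have "superhedgeable \<S> R 0 1 (\<lambda>X. if X \<in> E then \<infinity> else 0)"
    using path_null_iff_null_at[OF E] null R unfolding null_at_def by simp
  then obtain V H where nonneg: "\<And>m. nonneg_portfolio \<S> R 0 (V m) (H m)"
    and cost: "(\<Sum>m. ereal (V m)) \<le> ereal 1"
    and payoff: "\<And>X. X \<in> node \<S> R 0 \<Longrightarrow>
      (if X \<in> E then \<infinity> else 0) \<le> (\<Sum>m. liminf_portfolio (V m) (H m) 0 X)"
    by (rule superhedgeableE) blast
  have V0: "0 \<le> V m" for m using nonneg_portfolio_start[OF nonneg R] .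
  have H: "H m \<in> strategies \<S> R 0" for m using nonneg[of m] by (simp add: nonneg_portfolio_def)
  have val0: "0 \<le> portfolio (V m) (H m) 0 j X" if "X \<in> \<S>" for m j X
    using nonneg[of m] root[OF that] by (simp add: nonneg_portfolio_def)
  define N where "N j = {X \<in> \<S>. (\<Sum>m. ereal (portfolio (V m) (H m) 0 j X)) = \<infinity>}" for j
  have "path_null \<S> (N j)" for j
  proof -
    have "null_at \<S> R 0 (N j)"
      unfolding null_at_def
    proof (intro allI impI)
      fix e :: real assume e: "e > 0"
      show "superhedgeable \<S> R 0 e (\<lambda>X. if X \<in> N j then \<infinity> else 0)"
      proof (rule superhedgeableI)
        let ?H = "\<lambda>m i X. if i < j then e * H m i X else 0"
        show "nonneg_portfolio \<S> R 0 (e * V m) (?H m)" for m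
          using nonneg_portfolio_stop[OF nonneg_portfolio_scale[OF nonneg]] e by simp
        have "(\<Sum>m. ereal (e * V m)) = ereal e * (\<Sum>m. ereal (V m))"
          using suminf_cmult_ereal[of "\<lambda>m. ereal (V m)" "ereal e"] V0 e by simp
        also have "\<dots> \<le> ereal e * ereal 1"
          using cost e by (intro ereal_mult_left_mono) simp_all
        finally show "(\<Sum>m. ereal (e * V m)) \<le> ereal e" by simp
        fix X assume "X \<in> node \<S> R 0"
        then have X: "X \<in> \<S>" by (simp add: node_def)
        have "(\<Sum>m. liminf_portfolio (e * V m) (?H m) 0 X) =
            (\<Sum>m. ereal e * ereal (portfolio (V m) (H m) 0 j X))"
          by (simp add: liminf_portfolio_stop portfolio_scale)
        also have "\<dots> = ereal e * (\<Sum>m. ereal (portfolio (V m) (H m) 0 j X))"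
          using val0[OF X] e by (intro suminf_cmult_ereal) simp_all
        finally have *: "(\<Sum>m. liminf_portfolio (e * V m) (?H m) 0 X) =
          ereal e * (\<Sum>m. ereal (portfolio (V m) (H m) 0 j X))" .
        have "0 \<le> (\<Sum>m. ereal (portfolio (V m) (H m) 0 j X))"
          using val0[OF X] by (intro suminf_0_le) simp
        then show "(if X \<in> N j then \<infinity> else 0) \<le> (\<Sum>m. liminf_portfolio (e * V m) (?H m) 0 X)"
          unfolding * N_def using e by simp
      qed
    qed
    then have "\<forall>S\<in>\<S>. null_at \<S> S 0 (N j)"
      unfolding null_at_def by (simp add: superhedgeable_node_eq[OF root])
    then show ?thesis by (subst path_null_iff_null_at) (auto simp: N_def)
  qed
  then have N: "path_null \<S> (\<Union>j. N j)" by (rule path_null_UN)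
  have "null_at \<S> S j E" if S: "S \<in> \<S>" "S \<notin> (\<Union>j. N j)" for S j
    unfolding null_at_def
  proof (intro allI impI)
    fix e :: real assume e: "e > 0"
    let ?v = "\<lambda>m. portfolio (V m) (H m) 0 j S"
    have fin: "(\<Sum>m. ereal (?v m)) \<noteq> \<infinity>" using S by (auto simp: N_def)
    \<comment> \<open>The summand 1 keeps the denominator positive when the current total wealth is
      zero; the scaled wealth is then at most \<open>e\<close>.\<close>
    define c where "c = e / (suminf ?v + 1)"
    have v: "(\<Sum>m. ereal (?v m)) = ereal (suminf ?v)" "summable ?v"
      using suminf_ereal[OF val0[OF S(1)] fin] summable_ereal[OF val0[OF S(1)] fin] by simp_all
    have s0: "0 \<le> suminf ?v" using v(2) val0[OF S(1)] by (intro suminf_nonneg)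
    then have c: "c > 0" "c * suminf ?v \<le> e" using e by (simp_all add: c_def field_simps)
    show "superhedgeable \<S> S j e (\<lambda>X. if X \<in> E then \<infinity> else 0)"
    proof (rule superhedgeableI)
      show "nonneg_portfolio \<S> S j (c * ?v m) (\<lambda>i X. c * H m i X)" for m
        using nonneg_portfolio_scale[OF nonneg_portfolio_restart[OF nonneg root[OF S(1)]]] c by simp
      have "(\<Sum>m. ereal (c * ?v m)) = ereal c * (\<Sum>m. ereal (?v m))"
        using suminf_cmult_ereal[of "\<lambda>m. ereal (?v m)" "ereal c"] val0[OF S(1)] c by simp
      then show "(\<Sum>m. ereal (c * ?v m)) \<le> ereal e" using v c by simp
      fix X assume X: "X \<in> node \<S> S j"
      then have XS: "X \<in> node \<S> R 0" using root node_subset by blast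
      have "(\<Sum>m. liminf_portfolio (c * ?v m) (\<lambda>i X. c * H m i X) j X) =
          (\<Sum>m. ereal c * liminf_portfolio (V m) (H m) 0 X)"
        using c liminf_portfolio_restart[OF H root[OF S(1)] X] by (simp add: liminf_portfolio_scale)
      also have "\<dots> = ereal c * (\<Sum>m. liminf_portfolio (V m) (H m) 0 X)"
        using liminf_portfolio_nonneg[OF nonneg XS] c by (intro suminf_cmult_ereal) simp_all
      finally have *: "(\<Sum>m. liminf_portfolio (c * ?v m) (\<lambda>i X. c * H m i X) j X) =
          ereal c * (\<Sum>m. liminf_portfolio (V m) (H m) 0 X)" .
      show "(if X \<in> E then \<infinity> else 0) \<le>
          (\<Sum>m. liminf_portfolio (c * ?v m) (\<lambda>i X. c * H m i X) j X)"
        unfolding * using payoff[OF XS] c by (cases "X \<in> E") simp_all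
    qed
  qed
  then show ?thesis using that N by blast
qed

lemma path_null_empty: "path_null \<S> {}"
proof -
  have "null_at \<S> S 0 {}" for S
    unfolding null_at_def
  proof (intro allI impI)
    fix e :: real assume "0 < e"
    then show "superhedgeable \<S> S 0 e (\<lambda>X. if X \<in> {} then \<infinity> else 0)"
      by (intro superhedgeable_mono[OF superhedgeable_const]) simp_all
  qed
  then show ?thesis by (simp add: path_null_iff_null_at)
qed

text \<open>At a node that is not up-down, trading in the only possible direction costs nothing.\<close>

lemma path_null_one_sided_moves:
  "path_null \<S> {X \<in> \<S>. \<exists>k. \<not> up_down_node \<S> X k \<and> X (Suc k) \<noteq> X k}"
proof -
  define N where "N k = {X \<in> \<S>. \<not> up_down_node \<S> X k \<and> X (Suc k) \<noteq> X k}" for k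
  have "path_null \<S> (N k)" for k
  proof -
    \<comment> \<open>Trading takes place only at time \<open>k\<close>: one unit is bought if some
      continuation rises, and otherwise one unit is sold. Without upward and downward continuations
      at once, this gains the absolute price change.\<close>
    define H :: "nat \<Rightarrow> path \<Rightarrow> real" where
      "H i X = (if i = k \<and> \<not> up_down_node \<S> X k
        then if \<exists>Y\<in>node \<S> X k. X k < Y (Suc k) then 1 else -1 else 0)" for i X
    have adapted: "H i Y = H i X" if "Y \<in> node \<S> X i" for i X Y
    proof (cases "i = k")
      case True
      have Y: "Y \<in> node \<S> X k" using True that by simp
      then have "Y k = X k" by (simp add: node_def)
      then show ?thesis unfolding H_def by (simp add: up_down_node_eq[OF Y] node_eqI[OF Y])
    qed (simp add: H_def)
    have gain: "H k X * (X (Suc k) - X k) = (if up_down_node \<S> X k then 0 else \<bar>X (Suc k) - X k\<bar>)"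
      if X: "X \<in> \<S>" for X
    proof (cases "up_down_node \<S> X k")
      case False
      show ?thesis
      proof (cases "\<exists>Y\<in>node \<S> X k. X k < Y (Suc k)")
        case True
        then have "\<not> X (Suc k) < X k"
          using False in_nodeI[OF X] unfolding up_down_node_def by blast
        then show ?thesis using True False by (simp add: H_def)
      next
        case noup: False
        then have "\<not> X k < X (Suc k)" using in_nodeI[OF X] by blast
        then show ?thesis using noup False by (simp add: H_def)
      qed
    qed (simp add: H_def)
    have val: "portfolio 0 H 0 n X = (if k < n then H k X * (X (Suc k) - X k) else 0)" for n X
    proof (induction n)
      case (Suc n)
      then show ?case by (cases "n = k") (auto simp: portfolio_step H_def)
    qed simp
    have "null_at \<S> S 0 (N k)" if S: "S \<in> \<S>" for S
      unfolding null_at_def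
    proof (intro allI impI)
      fix e :: real assume e: "e > 0"
      have nonneg: "nonneg_portfolio \<S> S 0 0 H"
        unfolding nonneg_portfolio_def
      proof (intro conjI allI impI ballI)
        show "H \<in> strategies \<S> S 0" by (rule strategiesI) (rule adapted)
        fix n X assume "X \<in> node \<S> S 0"
        then have "X \<in> \<S>" by (simp add: node_def)
        then show "0 \<le> portfolio 0 H 0 n X" by (simp add: val gain)
      qed
      \<comment> \<open>The hedge has zero cost, so countably many copies of it are free and turn a
        positive gain into infinity.\<close>
      let ?g = "\<lambda>X. \<Sum>m::nat. liminf_portfolio 0 H 0 X"
      have "superhedgeable \<S> S 0 e ?g"
        by (rule superhedgeable_suminf[OF S superhedgeable_portfolio[OF nonneg]])
          (use e liminf_portfolio_nonneg[OF nonneg] in \<open>simp_all flip: zero_ereal_def\<close>)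
      then show "superhedgeable \<S> S 0 e (\<lambda>X. if X \<in> N k then \<infinity> else 0)"
      proof (rule superhedgeable_mono)
        fix X assume X: "X \<in> node \<S> S 0"
        then have XS: "X \<in> \<S>" by (simp add: node_def)
        have "?g X = \<infinity>" if "X \<in> N k"
        proof -
          have "liminf_portfolio 0 H 0 X = ereal (portfolio 0 H 0 (Suc k) X)"
            by (rule liminf_portfolio_finite_horizon) (simp_all add: H_def)
          also have "\<dots> = ereal \<bar>X (Suc k) - X k\<bar>"
            using that by (simp add: val gain[OF XS] N_def)
          finally have "liminf_portfolio 0 H 0 X = ereal \<bar>X (Suc k) - X k\<bar>" .
          then show ?thesis using that by (simp add: suminf_const_infinity N_def)
        qed
        moreover have "0 \<le> ?g X"
          by (rule suminf_0_le) (rule liminf_portfolio_nonneg[OF nonneg X])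
        ultimately show "(if X \<in> N k then \<infinity> else 0) \<le> ?g X" by simp
      qed
    qed
    then show ?thesis by (subst path_null_iff_null_at) (auto simp: N_def)
  qed
  then have "path_null \<S> (\<Union>k. N k)" by (rule path_null_UN)
  also have "(\<Union>k. N k) = {X \<in> \<S>. \<exists>k. \<not> up_down_node \<S> X k \<and> X (Suc k) \<noteq> X k}"
    by (auto simp: N_def)
  finally show ?thesis .
qed

section \<open>Hedging over one period\<close>

lemma portfolio_uminus: "portfolio (a - b) (\<lambda>i X. - K i X) j n X = a - portfolio b K j n X"
  by (simp add: portfolio_def sum_negf)

text \<open>After one period every portfolio of a superhedge is affine in the next price. Property
  \<open>(L)\<close> at a successor bounds \<open>g\<close> there by the total wealth at that time,
  and the slopes are added up to \<open>G\<close>. At a node that is not up-down only successors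
  with unchanged price are considered, so the slope is irrelevant and 0 is chosen.\<close>

lemma one_step_hedge:
  fixes g :: "path \<Rightarrow> real"
  assumes X: "X \<in> \<S>" and e: "e > 0"
    and sigma: "sigma_bar_nat \<S> i (\<lambda>Y. ereal (g Y)) X \<le> ereal c"
    and g: "\<And>Y Z. Y \<in> node \<S> X i \<Longrightarrow> Z \<in> node \<S> Y (Suc i) \<Longrightarrow> g Z = g Y"
  obtains G where "\<not> up_down_node \<S> X i \<Longrightarrow> G = 0"
    "\<And>Y. Y \<in> node \<S> X i \<Longrightarrow> property_L \<S> Y (Suc i) \<Longrightarrow>
       up_down_node \<S> X i \<or> Y (Suc i) = X i \<Longrightarrow> g Y \<le> c + e + G * (Y (Suc i) - X i)"
proof -
  have "sigma_bar_nat \<S> i (\<lambda>Y. ereal (g Y)) X < ereal (c + e)"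
    by (rule le_less_trans[OF sigma]) (use e in simp)
  then obtain V0 H0 n0 V H where
    H0: "H0 \<in> strategies \<S> X i" "i \<le> n0" and
    nonneg: "\<forall>m. nonneg_portfolio \<S> X i (V m) (H m)" and
    dom: "\<forall>Y\<in>node \<S> X i.
      ereal (g Y) \<le> ereal (portfolio V0 H0 i n0 Y) + (\<Sum>m. liminf_portfolio (V m) (H m) i Y)" and
    cost: "ereal V0 + (\<Sum>m. ereal (V m)) < ereal (c + e)"
    unfolding sigma_bar_nat_def Inf_less_iff by (elim bexE CollectE exE conjE) simp
  have H: "H m \<in> strategies \<S> X i" for m using nonneg by (simp add: nonneg_portfolio_def)
  have V: "0 \<le> V m" for m using nonneg_portfolio_start[OF _ X] nonneg by blast
  have fin: "(\<Sum>m. ereal (V m)) \<noteq> \<infinity>" using cost by auto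
  have sumV: "summable V" using summable_ereal[OF V fin] .
  have cost': "V0 + suminf V < c + e" using cost suminf_ereal[OF V fin] by simp
  \<comment> \<open>Extending the strategy by zero keeps its payoff and allows a horizon
    \<open>n\<close> of at least \<open>Suc i\<close>, as property \<open>(L)\<close> at the
    successor requires, even if \<open>n0 = i\<close>.\<close>
  define K where "K = (\<lambda>k Y. if k < n0 then H0 k Y else 0)"
  define n where "n = max n0 (Suc i)"
  have K: "K \<in> strategies \<S> X i" unfolding K_def by (rule strategies_stop[OF H0(1)])
  have Kn: "portfolio V0 K i n Y = portfolio V0 H0 i n0 Y" for Y
    using portfolio_stop[of i n V0 n0 H0 Y] H0(2) by (simp add: K_def n_def max_def)
  define h where "h m = H m i X" for m
  have step: "portfolio v J i (Suc i) Y = v + J i X * (Y (Suc i) - X i)"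
    if "J \<in> strategies \<S> X i" "Y \<in> node \<S> X i" for v J Y
    using strategies_adapted[OF that(1) in_nodeI[OF X] that(2)] that(2)
    by (simp add: portfolio_step node_def)
  have pos: "0 \<le> V m + h m * (Y (Suc i) - X i)" if "Y \<in> node \<S> X i" for m Y
    using nonneg step[OF H that, of "V m" m] that unfolding nonneg_portfolio_def h_def
    by (metis le_Suc_eq order_refl)
  \<comment> \<open>Non-negative wealth after a downward and after an upward move bounds each slope
    from above and below by multiples of \<open>V m\<close>, so the slopes inherit summability from
    the capitals.\<close>
  have sumh: "summable h" if ud: "up_down_node \<S> X i"
  proof -
    obtain Y Z where YZ: "Y \<in> node \<S> X i" "Z \<in> node \<S> X i" "Y (Suc i) < X i" "X i < Z (Suc i)"
      using ud unfolding up_down_node_def by blast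
    define a b where "a = X i - Y (Suc i)" and "b = Z (Suc i) - X i"
    have ab: "a > 0" "b > 0" using YZ by (simp_all add: a_def b_def)
    have "norm (h m) \<le> V m * (1 / a + 1 / b)" for m
    proof -
      have "h m * a \<le> V m" "- h m * b \<le> V m"
        using pos[OF YZ(1), of m] pos[OF YZ(2), of m] by (simp_all add: a_def b_def algebra_simps)
      then have "h m \<le> V m / a" "- h m \<le> V m / b" using ab by (simp_all add: field_simps)
      moreover have "0 \<le> V m / a" "0 \<le> V m / b" using ab V by simp_all
      ultimately show ?thesis by (simp add: distrib_left)
    qed
    then show ?thesis
      by (intro summable_comparison_test'[OF summable_mult2[OF sumV], of 0 h])
  qed
  define G where "G = (if up_down_node \<S> X i then K i X + suminf h else 0)"
  have "g Y \<le> c + e + G * (Y (Suc i) - X i)"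
    if Y: "Y \<in> node \<S> X i" and L: "property_L \<S> Y (Suc i)"
      and move: "up_down_node \<S> X i \<or> Y (Suc i) = X i" for Y
  proof -
    define d where "d = Y (Suc i) - X i"
    have sums: "(\<lambda>m. V m + h m * d) sums (suminf V + (if up_down_node \<S> X i then suminf h else 0) * d)"
    proof (cases "up_down_node \<S> X i")
      case True
      then show ?thesis
        using sums_add[OF summable_sums[OF sumV] sums_mult2[OF summable_sums[OF sumh]], of d] by simp
    next
      case False
      then show ?thesis using move summable_sums[OF sumV] by (simp add: d_def)
    qed
    \<comment> \<open>The elementary part is moved to the left: starting with this difference and
      trading \<open>- K\<close> yields \<open>g Z\<close> minus the elementary payoff, which the
      restarted liminf portfolios dominate.\<close>
    have "ereal (g Y - portfolio V0 K i (Suc i) Y) \<le>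
        (\<Sum>m. ereal (portfolio (V m) (H m) i (Suc i) Y))"
    proof (rule L[unfolded property_L_def, rule_format])
      show "(\<lambda>i X. - K i X) \<in> strategies \<S> Y (Suc i)"
        using strategies_compose[OF strategies_later[OF K Y], of "Suc i" "\<lambda>_. uminus"] by simp
      show "Suc i \<le> n" by (simp add: n_def)
      show "nonneg_portfolio \<S> Y (Suc i) (portfolio (V m) (H m) i (Suc i) Y) (H m)" for m
        using nonneg_portfolio_restart[of \<S> X i "V m" "H m" Y "Suc i"] nonneg Y by simp
      fix Z assume Z: "Z \<in> node \<S> Y (Suc i)"
      have ZX: "Z \<in> node \<S> X i" using node_later[OF Y, of "Suc i"] Z by auto
      have "portfolio (portfolio V0 K i (Suc i) Y) K (Suc i) n Z = portfolio V0 K i n Z"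
        using portfolio_concat[of i "Suc i" n V0 K Z] portfolio_node[OF K Y Z, of V0]
        by (simp add: n_def)
      then have *: "portfolio (g Y - portfolio V0 K i (Suc i) Y) (\<lambda>i X. - K i X) (Suc i) n Z =
          g Z - portfolio V0 H0 i n0 Z"
        by (simp add: portfolio_uminus Kn g[OF Y Z])
      have **: "(\<Sum>m. liminf_portfolio (portfolio (V m) (H m) i (Suc i) Y) (H m) (Suc i) Z) =
          (\<Sum>m. liminf_portfolio (V m) (H m) i Z)"
        by (rule suminf_cong) (rule liminf_portfolio_restart[OF H Y Z], simp)
      have le: "ereal (g Z) \<le> ereal (portfolio V0 H0 i n0 Z) + (\<Sum>m. liminf_portfolio (V m) (H m) i Z)"
        using dom ZX by blast
      show "ereal (portfolio (g Y - portfolio V0 K i (Suc i) Y) (\<lambda>i X. - K i X) (Suc i) n Z) \<le>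
        (\<Sum>m. liminf_portfolio (portfolio (V m) (H m) i (Suc i) Y) (H m) (Suc i) Z)"
        unfolding * ** using le
        by (cases "\<Sum>m. liminf_portfolio (V m) (H m) i Z") simp_all
    qed
    also have "\<dots> = (\<Sum>m. ereal (V m + h m * d))"
      by (simp add: step[OF H Y] h_def d_def)
    also have "\<dots> = ereal (suminf V + (if up_down_node \<S> X i then suminf h else 0) * d)"
      using sums_unique[OF iffD2[OF sums_ereal sums]] by simp
    finally have "g Y \<le> V0 + K i X * d + (suminf V + (if up_down_node \<S> X i then suminf h else 0) * d)"
      by (simp add: step[OF K Y] d_def)
    also have "\<dots> \<le> c + e + G * d"
      using cost' move by (auto simp: G_def d_def algebra_simps)
    finally show ?thesis by (simp add: d_def)
  qed
  then show ?thesis using that[of G] by (simp add: G_def)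
qed

section \<open>Optional sampling\<close>

text \<open>A counterpart of \<open>process_at\<close> for real processes indexed by all times; any
  extension beyond a horizon is built into \<open>g\<close>.\<close>

definition process_value :: "(nat \<Rightarrow> path \<Rightarrow> real) \<Rightarrow> enat \<Rightarrow> path \<Rightarrow> ereal" where
  "process_value g t X =
    (case t of enat j \<Rightarrow> ereal (g j X) | \<infinity> \<Rightarrow> liminf (\<lambda>n. ereal (g n X)))"

text \<open>Regularity has to be visible at time \<open>n\<close>, since the strategy depends on it.
  Hence the conditions on nodes run up to \<open>n\<close>, but those on price moves only up to the
  move that ends at time \<open>n\<close>.\<close>

definition regular_until :: "path set \<Rightarrow> (nat \<Rightarrow> path \<Rightarrow> real) \<Rightarrow> path \<Rightarrow> nat \<Rightarrow> bool" where
  "regular_until \<S> g X n \<longleftrightarrow>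
    (\<forall>k\<le>n. property_L \<S> X k \<and> sigma_bar_nat \<S> k (\<lambda>Y. ereal (g (Suc k) Y)) X \<le> ereal (g k X)) \<and>
    (\<forall>k<n. up_down_node \<S> X k \<or> X (Suc k) = X k)"

lemma regular_until_node_eq:
  assumes "\<And>n X Y. X \<in> \<S> \<Longrightarrow> Y \<in> node \<S> X n \<Longrightarrow> g n Y = g n X"
    and X: "X \<in> \<S>" and Y: "Y \<in> node \<S> X n"
  shows "regular_until \<S> g Y n = regular_until \<S> g X n"
proof -
  have "property_L \<S> Y k = property_L \<S> X k" "g k Y = g k X"
    "sigma_bar_nat \<S> k h Y = sigma_bar_nat \<S> k h X" "up_down_node \<S> Y k = up_down_node \<S> X k"
    if "k \<le> n" for k h
    using node_earlier[OF Y that] assms(1)[OF X]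
    by (simp_all add: property_L_node_eq[OF node_earlier[OF Y that]]
        sigma_bar_nat_node_eq[OF node_earlier[OF Y that]] up_down_node_eq[OF node_earlier[OF Y that]])
  moreover have "Y k = X k" if "k \<le> n" for k using Y that by (simp add: node_def)
  ultimately show ?thesis unfolding regular_until_def by (simp add: less_imp_le Suc_leI)
qed

text \<open>If two paths agree up to \<open>n\<close> and one of them has stopped by then, the
  defining condition forces the same stopping time on the other. This applies in both
  directions.\<close>

lemma stopping_time_node:
  assumes st: "stopping_time \<S> \<tau>" and X: "X \<in> \<S>" and Y: "Y \<in> node \<S> X n"
  shows "enat n < \<tau> Y \<longleftrightarrow> enat n < \<tau> X" and "\<tau> X \<le> enat n \<Longrightarrow> \<tau> Y = \<tau> X"
proof -
  have same: "\<tau> A = \<tau> B" if "A \<in> \<S>" "B \<in> \<S>" "\<tau> A \<le> enat n" "\<forall>k\<le>n. A k = B k" for A B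
  proof -
    have "\<forall>k. enat k \<le> \<tau> A \<longrightarrow> A k = B k"
      using that(3,4) by (metis enat_ord_simps(1) order_trans)
    then show ?thesis using st that(1,2) unfolding stopping_time_def by blast
  qed
  have Y': "Y \<in> \<S>" "\<forall>k\<le>n. X k = Y k" "\<forall>k\<le>n. Y k = X k" using Y by (auto simp: node_def)
  show "\<tau> X \<le> enat n \<Longrightarrow> \<tau> Y = \<tau> X" using same[OF X Y'(1) _ Y'(2)] by simp
  moreover have "\<tau> Y \<le> enat n \<Longrightarrow> \<tau> Y = \<tau> X" using same[OF Y'(1) X _ Y'(3)] by simp
  ultimately show "enat n < \<tau> Y \<longleftrightarrow> enat n < \<tau> X" by (metis not_le)
qed

text \<open>The hedge consists of one non-negative portfolio that follows the one-period slopes,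
  plus a cheap infinite payoff on \<open>E\<close>.\<close>

lemma optional_sampling_at_node:
  fixes g :: "nat \<Rightarrow> path \<Rightarrow> real"
  assumes P: "property_P \<S>"
    and nn: "\<And>n X. X \<in> \<S> \<Longrightarrow> 0 \<le> g n X"
    and adapted: "\<And>n X Y. X \<in> \<S> \<Longrightarrow> Y \<in> node \<S> X n \<Longrightarrow> g n Y = g n X"
    and st: "stopping_time \<S> \<tau>" and S: "S \<in> \<S>" and null: "null_at \<S> S j E"
    and regular: "\<And>X. X \<in> node \<S> S j \<Longrightarrow> X \<notin> E \<Longrightarrow>
      enat j \<le> \<tau> X \<and> (\<forall>n. regular_until \<S> g X n)"
  shows "sigma_bar_nat \<S> j (\<lambda>X. process_value g (\<tau> X) X) S \<le> ereal (g j S)"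
proof (rule ereal_le_epsilon2)
  fix e' :: real assume "0 < e'"
  \<comment> \<open>One half pays for the errors of the one-period hedges, the other for covering
    \<open>E\<close>.\<close>
  define e where "e = e' / 2"
  have e: "e > 0" using \<open>0 < e'\<close> by (simp add: e_def)
  define Q where "Q i X G \<longleftrightarrow> (\<not> up_down_node \<S> X i \<longrightarrow> G = 0) \<and>
    (\<forall>Y\<in>node \<S> X i. property_L \<S> Y (Suc i) \<longrightarrow> up_down_node \<S> X i \<or> Y (Suc i) = X i \<longrightarrow>
      g (Suc i) Y \<le> g i X + e / 2 ^ Suc i + G * (Y (Suc i) - X i))" for i X G
  \<comment> \<open>Position 0 is the default once the path has stopped or is no longer regular,
    which freezes the wealth.\<close>
  define H where "H i X =
    (if regular_until \<S> g X i \<and> enat i < \<tau> X then SOME G. Q i X G else 0)" for i X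
  define W where "W n X = portfolio (g j S + e) H j n X" for n X
  \<comment> \<open>The predicates are equal as functions of \<open>G\<close>, so
    \<open>SOME\<close> picks the same slope on the whole node and \<open>H\<close> is
    non-anticipative.\<close>
  have Q_node: "Q i Y = Q i X" if "X \<in> \<S>" "Y \<in> node \<S> X i" for i X Y
    using adapted[OF that] that(2)
    by (intro ext) (simp add: Q_def up_down_node_eq[OF that(2)] node_eqI[OF that(2)], simp add: node_def)
  have adapted_H: "H i Y = H i X" if "X \<in> \<S>" "Y \<in> node \<S> X i" for i X Y
  proof -
    have "regular_until \<S> g Y i = regular_until \<S> g X i"
      by (rule regular_until_node_eq[OF _ that]) (rule adapted)
    then show ?thesis by (simp add: H_def Q_node[OF that] stopping_time_node(1)[OF st that])
  qed
  have Q: "Q i X (H i X)" if "X \<in> \<S>" "regular_until \<S> g X i" "enat i < \<tau> X" for i X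
  proof -
    have "e / 2 ^ Suc i > 0" using e by simp
    moreover have "sigma_bar_nat \<S> i (\<lambda>Y. ereal (g (Suc i) Y)) X \<le> ereal (g i X)"
      using that(2) by (simp add: regular_until_def)
    moreover have "g (Suc i) Z = g (Suc i) Y" if "Y \<in> node \<S> X i" "Z \<in> node \<S> Y (Suc i)" for Y Z
      using that adapted node_subset by blast
    ultimately have "\<exists>G. Q i X G"
    proof (rule one_step_hedge[OF that(1), where g = "g (Suc i)"])
      fix G
      assume "\<not> up_down_node \<S> X i \<Longrightarrow> G = 0"
        and "\<And>Y. Y \<in> node \<S> X i \<Longrightarrow> property_L \<S> Y (Suc i) \<Longrightarrow>
          up_down_node \<S> X i \<or> Y (Suc i) = X i \<Longrightarrow>
          g (Suc i) Y \<le> g i X + e / 2 ^ Suc i + G * (Y (Suc i) - X i)"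
      then have "Q i X G" unfolding Q_def by blast
      then show ?thesis by (rule exI)
    qed
    then have "Q i X (SOME G. Q i X G)" by (rule someI_ex)
    then show ?thesis using that by (simp add: H_def)
  qed
  have W_Suc: "W (Suc n) X = W n X + H n X * (X (Suc n) - X n)" if "j \<le> n" for n X
    using that by (simp add: W_def portfolio_step)
  have half: "e / 2 ^ n = e / 2 ^ Suc n + e / 2 ^ Suc n" for n by simp
  \<comment> \<open>The surplus over \<open>g\<close> is at least \<open>e / 2 ^ n\<close> at time
    \<open>n\<close>: each period consumes at most half of it.\<close>
  have above: "g n X + e / 2 ^ n \<le> W n X"
    if "j \<le> n" "X \<in> node \<S> S j" "regular_until \<S> g X n" "enat n \<le> \<tau> X" for n X
    using that(1,3,4)
  proof (induction n rule: dec_induct)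
    case base
    have "e / 2 ^ j \<le> e" using e by (simp add: field_simps)
    then show ?case using adapted[OF S that(2)] by (simp add: W_def)
  next
    case (step n)
    have X: "X \<in> \<S>" using that(2) by (simp add: node_def)
    have reg: "regular_until \<S> g X n" "property_L \<S> X (Suc n)"
      "up_down_node \<S> X n \<or> X (Suc n) = X n"
      using step.prems by (auto simp: regular_until_def)
    have \<tau>: "enat n < \<tau> X" using step.prems by (simp add: Suc_ile_eq)
    have "g n X + e / 2 ^ n \<le> W n X" using step.IH reg \<tau> by simp
    moreover have "g (Suc n) X \<le> g n X + e / 2 ^ Suc n + H n X * (X (Suc n) - X n)"
      using Q[OF X reg(1) \<tau>] in_nodeI[OF X] reg unfolding Q_def by blast
    ultimately show ?case using half[of n] W_Suc[OF step.hyps(1), of X] by linarith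
  qed
  \<comment> \<open>Only a step with a non-zero position needs an argument. Such a step starts at a
    regular up-down node before \<tau>, where \<open>above\<close> applies; regularity of the
    successor is not assumed.\<close>
  have W_nonneg: "0 \<le> W n X" if "j \<le> n" "X \<in> node \<S> S j" for n X
    using that(1)
  proof (induction n rule: dec_induct)
    case base
    then show ?case using nn[OF S] e by (simp add: W_def)
  next
    case (step n)
    have X: "X \<in> \<S>" using that(2) by (simp add: node_def)
    show ?case
    proof (cases "H n X = 0")
      case True
      then show ?thesis using step W_Suc by simp
    next
      case False
      then have reg: "regular_until \<S> g X n" "enat n < \<tau> X"
        by (auto simp: H_def split: if_splits)
      have QX: "Q n X (H n X)" by (rule Q[OF X reg])
      then have ud: "up_down_node \<S> X n" using False by (auto simp: Q_def)
      have Wn: "g n X + e / 2 ^ n \<le> W n X" using above[OF step.hyps(1) that(2) reg(1)] reg(2) by simp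
      have reach: "0 \<le> W n X + H n X * (Y (Suc n) - X n)"
        if Y: "Y \<in> node \<S> X n" "property_L \<S> Y (Suc n)" for Y
      proof -
        have "g (Suc n) Y \<le> g n X + e / 2 ^ Suc n + H n X * (Y (Suc n) - X n)"
          using QX Y ud unfolding Q_def by blast
        moreover have "0 \<le> g (Suc n) Y" using nn Y(1) node_subset by blast
        moreover have "0 < e / 2 ^ Suc n" using e by simp
        ultimately show ?thesis using Wn half[of n] by linarith
      qed
      show ?thesis
      proof (cases "property_L \<S> X (Suc n)")
        case True
        then show ?thesis using reach[OF in_nodeI[OF X]] W_Suc[OF step.hyps(1)] by simp
      next
        case noL: False
        have "property_L \<S> X n" using reg(1) by (simp add: regular_until_def)
        then obtain A B where AB: "A \<in> node \<S> X n" "B \<in> node \<S> X n"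
          "A (Suc n) > X (Suc n)" "X (Suc n) > B (Suc n)"
          "property_L \<S> A (Suc n)" "property_L \<S> B (Suc n)"
          using P X ud noL unfolding property_P_def by blast
        \<comment> \<open>The wealth is affine in the next price, and it is non-negative at a price above and a
          price below.\<close>
        show ?thesis
        proof (cases "H n X \<ge> 0")
          case True
          then have "H n X * (B (Suc n) - X n) \<le> H n X * (X (Suc n) - X n)"
            using AB by (intro mult_left_mono) simp_all
          then show ?thesis using reach[OF AB(2,6)] W_Suc[OF step.hyps(1), of X] by linarith
        next
          case False
          then have "H n X * (A (Suc n) - X n) \<le> H n X * (X (Suc n) - X n)"
            using AB by (intro mult_left_mono_neg) simp_all
          then show ?thesis using reach[OF AB(1,5)] W_Suc[OF step.hyps(1), of X] by linarith
        qed
      qed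
    qed
  qed
  have nonneg: "nonneg_portfolio \<S> S j (g j S + e) H"
    unfolding nonneg_portfolio_def
  proof (intro conjI allI impI ballI)
    show "H \<in> strategies \<S> S j"
      by (rule strategiesI) (rule adapted_H, auto simp: node_def)
  qed (use W_nonneg in \<open>simp add: W_def\<close>)
  \<comment> \<open>Off \<open>E\<close> the path is regular at all times. If \<tau> is finite the
    wealth is frozen from then on, and otherwise the bound passes to the liminf.\<close>
  have dom: "process_value g (\<tau> X) X \<le> liminf_portfolio (g j S + e) H j X"
    if X: "X \<in> node \<S> S j" "X \<notin> E" for X
  proof -
    have reg: "enat j \<le> \<tau> X" "\<And>n. regular_until \<S> g X n" using regular[OF X] by auto
    have W: "g n X \<le> W n X" if "j \<le> n" "enat n \<le> \<tau> X" for n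
    proof -
      have "0 < e / 2 ^ n" using e by simp
      then show ?thesis using above[OF that(1) X(1) reg(2) that(2)] by linarith
    qed
    show ?thesis
    proof (cases "\<tau> X")
      case (enat t)
      have "liminf_portfolio (g j S + e) H j X = ereal (W t X)"
        unfolding W_def using enat reg(1)
        by (intro liminf_portfolio_finite_horizon) (simp_all add: H_def)
      then show ?thesis using W[of t] enat reg(1) by (simp add: process_value_def)
    next
      case infinity
      have "liminf (\<lambda>n. ereal (g n X)) \<le> liminf (\<lambda>n. ereal (portfolio (g j S + e) H j n X))"
        using W infinity
        by (intro Liminf_mono eventually_sequentiallyI[of j]) (simp add: W_def)
      then show ?thesis using infinity by (simp add: process_value_def liminf_portfolio_def)
    qed
  qed
  let ?E = "\<lambda>X. if X \<in> E then \<infinity> else 0 :: ereal"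
  have "superhedgeable \<S> S j e ?E" using null e by (simp add: null_at_def)
  then have "superhedgeable \<S> S j (g j S + e + e)
      (\<lambda>X. liminf_portfolio (g j S + e) H j X + ?E X)"
    using liminf_portfolio_nonneg[OF nonneg]
    by (intro superhedgeable_add[OF S superhedgeable_portfolio[OF nonneg]]) simp_all
  then have "superhedgeable \<S> S j (g j S + e + e) (\<lambda>X. process_value g (\<tau> X) X)"
    by (rule superhedgeable_mono) (use dom in \<open>simp split: if_splits\<close>)
  then have "sigma_bar_nat \<S> j (\<lambda>X. process_value g (\<tau> X) X) S \<le> ereal (g j S + e + e)"
    by (rule sigma_bar_nat_le)
  then show "sigma_bar_nat \<S> j (\<lambda>X. process_value g (\<tau> X) X) S \<le> ereal (g j S) + ereal e'"
    by (simp add: e_def add.commute)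
qed

section \<open>Almost-everywhere statements and sampling between two stopping times\<close>

lemma holds_ae_mono:
  "holds_ae \<S> p \<Longrightarrow> (\<And>S. S \<in> \<S> \<Longrightarrow> p S \<Longrightarrow> q S) \<Longrightarrow> holds_ae \<S> q"
  unfolding holds_ae_def by blast

lemma holds_ae_all: "(\<And>S. S \<in> \<S> \<Longrightarrow> p S) \<Longrightarrow> holds_ae \<S> p"
  unfolding holds_ae_def using path_null_empty by blast

lemma holds_ae_conj:
  assumes "holds_ae \<S> p" "holds_ae \<S> q"
  shows "holds_ae \<S> (\<lambda>S. p S \<and> q S)"
proof -
  obtain E F where "path_null \<S> E" "\<forall>S\<in>\<S> - E. p S" "path_null \<S> F" "\<forall>S\<in>\<S> - F. q S"
    using assms unfolding holds_ae_def by blast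
  then show ?thesis
    unfolding holds_ae_def by (intro exI[of _ "E \<union> F"] conjI path_null_Un) auto
qed

lemma holds_ae_all_nat:
  assumes "\<And>n::nat. holds_ae \<S> (p n)"
  shows "holds_ae \<S> (\<lambda>S. \<forall>n. p n S)"
proof -
  have "\<forall>n. \<exists>E. path_null \<S> E \<and> (\<forall>S\<in>\<S> - E. p n S)"
    using assms by (simp add: holds_ae_def)
  then obtain E where "\<forall>n. path_null \<S> (E n) \<and> (\<forall>S\<in>\<S> - E n. p n S)"
    by (rule choice[THEN exE])
  then show ?thesis
    unfolding holds_ae_def by (intro exI[of _ "\<Union>n. E n"] conjI path_null_UN) auto
qed

text \<open>All irregular paths are collected in one null set \<open>E\<close>. The argument at a
  single node applies off a second null set \<open>N\<close>, outside which \<open>E\<close> is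
  conditionally null at every node of the path.\<close>

lemma optional_sampling_real:
  fixes g :: "nat \<Rightarrow> path \<Rightarrow> real"
  assumes traj: "trajectory_set s0 \<S>" and L: "L_ae \<S>" and P: "property_P \<S>"
    and nn: "\<And>n X. X \<in> \<S> \<Longrightarrow> 0 \<le> g n X"
    and adapted: "\<And>n X Y. X \<in> \<S> \<Longrightarrow> Y \<in> node \<S> X n \<Longrightarrow> g n Y = g n X"
    and super: "\<And>n. holds_ae \<S> (\<lambda>S. sigma_bar_nat \<S> n (\<lambda>X. ereal (g (Suc n) X)) S \<le> ereal (g n S))"
    and \<rho>: "stopping_time \<S> \<rho>" and \<tau>: "stopping_time \<S> \<tau>"
    and le: "holds_ae \<S> (\<lambda>S. \<rho> S \<le> \<tau> S)"
  shows "holds_ae \<S> (\<lambda>S.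
    sigma_bar_at \<S> \<rho> (\<lambda>X. process_value g (\<tau> X) X) S \<le> process_value g (\<rho> S) S)"
proof -
  have "holds_ae \<S> (\<lambda>S. \<forall>j. property_L \<S> S j)"
    using L unfolding L_ae_def holds_ae_def by blast
  moreover have "holds_ae \<S> (\<lambda>S. \<forall>k. up_down_node \<S> S k \<or> S (Suc k) = S k)"
    using path_null_one_sided_moves[of \<S>] unfolding holds_ae_def by blast
  moreover have "holds_ae \<S> (\<lambda>S. \<forall>n.
      sigma_bar_nat \<S> n (\<lambda>X. ereal (g (Suc n) X)) S \<le> ereal (g n S))"
    using super by (rule holds_ae_all_nat)
  ultimately have "holds_ae \<S> (\<lambda>S. \<rho> S \<le> \<tau> S \<and>
      (\<forall>n. sigma_bar_nat \<S> n (\<lambda>X. ereal (g (Suc n) X)) S \<le> ereal (g n S)) \<and>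
      (\<forall>j. property_L \<S> S j) \<and> (\<forall>k. up_down_node \<S> S k \<or> S (Suc k) = S k))"
    by (intro holds_ae_conj le)
  then have "holds_ae \<S> (\<lambda>S. \<rho> S \<le> \<tau> S \<and> (\<forall>n. regular_until \<S> g S n))"
    by (rule holds_ae_mono) (simp add: regular_until_def)
  then obtain E where E: "path_null \<S> E"
    "\<And>S. S \<in> \<S> \<Longrightarrow> S \<notin> E \<Longrightarrow> \<rho> S \<le> \<tau> S \<and> (\<forall>n. regular_until \<S> g S n)"
    unfolding holds_ae_def by blast
  obtain N where N: "path_null \<S> N" "\<And>S j. S \<in> \<S> \<Longrightarrow> S \<notin> N \<Longrightarrow> null_at \<S> S j E"
    using null_at_almost_all_nodes[OF traj E(1)] by blast
  have "sigma_bar_at \<S> \<rho> (\<lambda>X. process_value g (\<tau> X) X) S \<le> process_value g (\<rho> S) S"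
    if S: "S \<in> \<S>" "S \<notin> E \<union> N" for S
  proof (cases "\<rho> S")
    case (enat j)
    have "sigma_bar_nat \<S> j (\<lambda>X. process_value g (\<tau> X) X) S \<le> ereal (g j S)"
    proof (rule optional_sampling_at_node[OF P nn adapted \<tau> S(1)])
      show "null_at \<S> S j E" using N(2) S by simp
      fix X assume X: "X \<in> node \<S> S j" "X \<notin> E"
      \<comment> \<open>The time \<rho> is constant on the node, so \<rho> \<le> \<tau> off
        \<open>E\<close> yields the bound \<open>j\<close> for \<tau>, as the node lemma
        requires.\<close>
      have "\<rho> X = enat j" using stopping_time_node(2)[OF \<rho> S(1) X(1)] enat by simp
      then show "enat j \<le> \<tau> X \<and> (\<forall>n. regular_until \<S> g X n)"
        using E(2)[of X] X node_subset by fastforce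
    qed
    then show ?thesis using enat by (simp add: sigma_bar_at_def sigma_bar_def process_value_def)
  next
    case infinity
    then have "\<tau> S = \<infinity>" using E(2)[OF S(1)] S(2) by simp
    then show ?thesis using infinity by (simp add: sigma_bar_at_def sigma_bar_def)
  qed
  then show ?thesis
    unfolding holds_ae_def using path_null_Un[OF E(1) N(1)] by blast
qed

section \<open>Reduction of the supermartingale to real processes without horizon\<close>

lemma sigma_bar_nat_node_const:
  assumes "0 \<le> c" "\<And>X. X \<in> node \<S> S j \<Longrightarrow> f X = ereal c"
  shows "sigma_bar_nat \<S> j f S \<le> ereal c"
  using assms
  by (intro sigma_bar_nat_le superhedgeable_mono[OF superhedgeable_const]) simp_all

theorem theorem4p5:
  fixes s0 :: real
    and \<S> :: "path set"
    and T :: enat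
    and f :: "nat \<Rightarrow> path \<Rightarrow> ereal"
    and \<rho> \<tau> :: "path \<Rightarrow> enat"
  assumes "trajectory_set s0 \<S>"
    and "L_ae \<S>"
    and "property_P \<S>"
    and "supermartingale \<S> T f"
    and "\<And>j S. enat j < T + 1 \<Longrightarrow> S \<in> \<S> \<Longrightarrow> 0 \<le> f j S \<and> f j S < \<infinity>"
    and "stopping_time \<S> \<rho>"
    and "stopping_time \<S> \<tau>"
    and "holds_ae \<S> (\<lambda>S. \<rho> S \<le> \<tau> S)"
  shows "holds_ae \<S> (\<lambda>S.
           sigma_bar_at \<S> \<rho> (stopped_process T f \<tau>) S \<le> stopped_process T f \<rho> S)
       \<and> holds_ae \<S> (\<lambda>S.
           sigma_bar_at \<S> \<rho>
             (\<lambda>X. indicator {Y. \<tau> Y < T + 1} X * stopped_process T f \<tau> X) S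
           \<le> indicator {Y. \<rho> Y < T + 1} S * stopped_process T f \<rho> S)"
proof -
  define F where "F = extend_process T f"
  define g where "g j X = real_of_ereal (F j X)" for j X
  \<comment> \<open>The process killed after the horizon serves the second claim.\<close>
  define g0 where "g0 j X = (if enat j < T + 1 then g j X else 0)" for j X
  have index: "enat j < T + 1 \<longleftrightarrow> enat j \<le> T" for j
    by (cases T) (auto simp: one_enat_def)
  \<comment> \<open>A time beyond the horizon exists only for finite \<open>T\<close>, so
    \<open>the_enat T\<close> is then the true horizon.\<close>
  have T_index: "enat (the_enat T) < T + 1" "the_enat T \<le> j" if "\<not> enat j < T + 1" for j
    using that by (cases T; simp add: one_enat_def)+
  have F_range: "0 \<le> F j X \<and> F j X < \<infinity>" if "X \<in> \<S>" for j X
    using assms(5)[OF _ that] T_index by (simp add: F_def extend_process_def)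
  have g: "ereal (g j X) = F j X" if "X \<in> \<S>" for j X
    unfolding g_def using F_range[OF that, of j] by (intro ereal_real') auto
  have g_nonneg: "0 \<le> g j X" if "X \<in> \<S>" for j X
    unfolding g_def using F_range[OF that, of j] by (intro real_of_ereal_pos) simp
  have f_adapted: "f j Y = f j X" if "enat j < T + 1" "X \<in> \<S>" "Y \<in> node \<S> X j" for j X Y
    using assms(4) that unfolding supermartingale_def nonanticipative_def by blast
  have F_adapted: "F j Y = F j X" if "X \<in> \<S>" "Y \<in> node \<S> X j" for j X Y
    using f_adapted[of j, OF _ that] f_adapted[OF T_index(1) that(1) node_earlier[OF that(2)]]
      T_index(2)[of j]
    by (simp add: F_def extend_process_def)
  have g_adapted: "g j Y = g j X" if "X \<in> \<S>" "Y \<in> node \<S> X j" for j X Y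
    unfolding g_def F_adapted[OF that] ..
  have F_late: "F (Suc j) = F j" if "\<not> enat j < T" for j
    using that by (cases T) (auto simp: F_def extend_process_def fun_eq_iff one_enat_def less_Suc_eq)
  have early: "holds_ae \<S> (\<lambda>S. sigma_bar_nat \<S> j (\<lambda>X. ereal (g (Suc j) X)) S \<le> ereal (g j S))"
    if j: "enat j < T" for j
  proof (rule holds_ae_mono)
    have j': "enat j < T + 1" "enat (Suc j) < T + 1"
      using j by (auto simp: index Suc_ile_eq)
    show "holds_ae \<S> (\<lambda>S. sigma_bar \<S> (enat j) (f (Suc j)) S \<le> f j S)"
      using assms(4) j by (simp add: supermartingale_def)
    fix S assume S: "S \<in> \<S>" and le: "sigma_bar \<S> (enat j) (f (Suc j)) S \<le> f j S"
    have "sigma_bar_nat \<S> j (\<lambda>X. ereal (g (Suc j) X)) S \<le> sigma_bar_nat \<S> j (f (Suc j)) S"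
    proof (rule sigma_bar_nat_mono)
      fix X assume "X \<in> node \<S> S j"
      then have "X \<in> \<S>" by (simp add: node_def)
      then show "ereal (g (Suc j) X) \<le> f (Suc j) X"
        using g[of X "Suc j"] j'(2) by (simp add: F_def extend_process_def)
    qed
    also have "\<dots> \<le> f j S" using le by (simp add: sigma_bar_def)
    also have "\<dots> = ereal (g j S)" using g[OF S, of j] j'(1) by (simp add: F_def extend_process_def)
    finally show "sigma_bar_nat \<S> j (\<lambda>X. ereal (g (Suc j) X)) S \<le> ereal (g j S)" .
  qed
  \<comment> \<open>From the horizon on the extended process no longer changes, so its next value is
    constant on the node and is hedged by cash.\<close>
  have late: "holds_ae \<S> (\<lambda>S. sigma_bar_nat \<S> j (\<lambda>X. ereal (g (Suc j) X)) S \<le> ereal (g j S))"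
    if "\<not> enat j < T" for j
  proof (rule holds_ae_all)
    fix S assume S: "S \<in> \<S>"
    show "sigma_bar_nat \<S> j (\<lambda>X. ereal (g (Suc j) X)) S \<le> ereal (g j S)"
    proof (rule sigma_bar_nat_node_const)
      fix X assume X: "X \<in> node \<S> S j"
      show "ereal (g (Suc j) X) = ereal (g j S)"
        using g_adapted[OF S X] F_late[OF that] by (simp add: g_def)
    qed (rule g_nonneg[OF S])
  qed
  have super: "holds_ae \<S> (\<lambda>S. sigma_bar_nat \<S> j (\<lambda>X. ereal (g (Suc j) X)) S \<le> ereal (g j S))" for j
    using early late by blast
  have super0: "holds_ae \<S> (\<lambda>S. sigma_bar_nat \<S> j (\<lambda>X. ereal (g0 (Suc j) X)) S \<le> ereal (g0 j S))" for j
  proof (cases "enat j < T")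
    case True
    then show ?thesis using early by (simp add: g0_def index Suc_ile_eq less_imp_le)
  next
    case False
    \<comment> \<open>For \<open>j\<close> not below \<open>T\<close> the next time already lies
      beyond the horizon, so the claim to be hedged is 0.\<close>
    have "sigma_bar_nat \<S> j (\<lambda>X. ereal (g0 (Suc j) X)) S \<le> ereal (g0 j S)" if "S \<in> \<S>" for S
    proof -
      have "sigma_bar_nat \<S> j (\<lambda>X. ereal (g0 (Suc j) X)) S \<le> ereal 0"
        using False by (intro sigma_bar_nat_node_const) (simp_all add: g0_def index Suc_ile_eq)
      also have "\<dots> \<le> ereal (g0 j S)" using g_nonneg[OF that] by (simp add: g0_def)
      finally show ?thesis .
    qed
    then show ?thesis by (rule holds_ae_all)
  qed
  have stopped: "stopped_process T f \<sigma> X = process_value g (\<sigma> X) X" if "X \<in> \<S>" for \<sigma> X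
    using g[OF that]
    by (simp add: stopped_process_def process_at_def process_value_def F_def split: enat.split)
  have sigma_mono: "sigma_bar_nat \<S> j u S \<le> sigma_bar_nat \<S> j v S"
    if "\<And>X. X \<in> \<S> \<Longrightarrow> u X \<le> v X" for j u v S
    using that node_subset by (intro sigma_bar_nat_mono) blast
  have "holds_ae \<S> (\<lambda>S.
    sigma_bar_at \<S> \<rho> (\<lambda>X. process_value g (\<tau> X) X) S \<le> process_value g (\<rho> S) S)"
    by (rule optional_sampling_real[OF assms(1-3) g_nonneg g_adapted super assms(6-8)])
  then have part1: "holds_ae \<S> (\<lambda>S.
      sigma_bar_at \<S> \<rho> (stopped_process T f \<tau>) S \<le> stopped_process T f \<rho> S)"
  proof (rule holds_ae_mono)
    fix S assume S: "S \<in> \<S>"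
      and le: "sigma_bar_at \<S> \<rho> (\<lambda>X. process_value g (\<tau> X) X) S \<le> process_value g (\<rho> S) S"
    have "sigma_bar_at \<S> \<rho> (stopped_process T f \<tau>) S \<le>
        sigma_bar_at \<S> \<rho> (\<lambda>X. process_value g (\<tau> X) X) S"
      unfolding sigma_bar_at_def sigma_bar_def
      using sigma_mono[of "stopped_process T f \<tau>" "\<lambda>X. process_value g (\<tau> X) X"] stopped S
      by (simp split: enat.split)
    then show "sigma_bar_at \<S> \<rho> (stopped_process T f \<tau>) S \<le> stopped_process T f \<rho> S"
      using le stopped[OF S] by simp
  qed
  \<comment> \<open>Equality holds at finite times. At an infinite \<tau> the indicator vanishes for
    every \<open>T\<close>, and the liminf of a non-negative process is non-negative.\<close>
  have indicator_le: "indicator {Y. \<tau> Y < T + 1} X * stopped_process T f \<tau> X \<le> process_value g0 (\<tau> X) X"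
    if X: "X \<in> \<S>" for X
  proof (cases "\<tau> X")
    case (enat t)
    then show ?thesis using stopped[OF X] by (simp add: process_value_def g0_def)
  next
    case infinity
    have "0 \<le> liminf (\<lambda>n. ereal (g0 n X))"
      using g_nonneg[OF X] by (intro Liminf_bounded always_eventually) (simp add: g0_def)
    then show ?thesis using infinity by (simp add: process_value_def)
  qed
  have "holds_ae \<S> (\<lambda>S.
    sigma_bar_at \<S> \<rho> (\<lambda>X. process_value g0 (\<tau> X) X) S \<le> process_value g0 (\<rho> S) S)"
  proof (rule optional_sampling_real[OF assms(1-3) _ _ super0 assms(6-8)])
    show "0 \<le> g0 n X" if "X \<in> \<S>" for n X using g_nonneg[OF that] by (simp add: g0_def)
    show "g0 n Y = g0 n X" if "X \<in> \<S>" "Y \<in> node \<S> X n" for n X Y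
      using g_adapted[OF that] by (simp add: g0_def)
  qed
  then have part2: "holds_ae \<S> (\<lambda>S. sigma_bar_at \<S> \<rho>
      (\<lambda>X. indicator {Y. \<tau> Y < T + 1} X * stopped_process T f \<tau> X) S
    \<le> indicator {Y. \<rho> Y < T + 1} S * stopped_process T f \<rho> S)"
  \<comment> \<open>The relation \<rho> \<le> \<tau> is carried along for the case of infinite
    \<rho>: then \<tau> is infinite too and both indicators vanish. The inequality
    \<open>indicator_le\<close> alone would not settle this case.\<close>
  proof (rule holds_ae_mono[OF holds_ae_conj[OF _ assms(8)]], elim conjE)
    let ?u = "\<lambda>X. indicator {Y. \<tau> Y < T + 1} X * stopped_process T f \<tau> X"
    fix S assume S: "S \<in> \<S>" and le: "\<rho> S \<le> \<tau> S"
      "sigma_bar_at \<S> \<rho> (\<lambda>X. process_value g0 (\<tau> X) X) S \<le> process_value g0 (\<rho> S) S"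
    show "sigma_bar_at \<S> \<rho> ?u S \<le> indicator {Y. \<rho> Y < T + 1} S * stopped_process T f \<rho> S"
    proof (cases "\<rho> S")
      case (enat j)
      have "sigma_bar_nat \<S> j ?u S \<le> sigma_bar_nat \<S> j (\<lambda>X. process_value g0 (\<tau> X) X) S"
        by (rule sigma_mono) (rule indicator_le)
      also have "\<dots> \<le> ereal (g0 j S)"
        using le(2) enat by (simp add: sigma_bar_at_def sigma_bar_def process_value_def)
      also have "\<dots> = indicator {Y. \<rho> Y < T + 1} S * stopped_process T f \<rho> S"
        using enat stopped[OF S] by (simp add: process_value_def g0_def)
      finally show ?thesis using enat by (simp add: sigma_bar_at_def sigma_bar_def)
    next
      case infinity
      then show ?thesis using le(1) by (simp add: sigma_bar_at_def sigma_bar_def)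
    qed
  qed
  show ?thesis using part1 part2 by (rule conjI)
qed

end
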